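(* Restricted to inputs consisting of an implicational base $\Sigma$ over $X$ and a consistency-graph $G_c = (X, E_c)$ such that the closure system $\mathcal{F}$ associated to $\Sigma$ is biatomic and atomistic and, for every $x \in X$, every minimal generator $A_x$ of $x$ is independent, the problem MCCEnum can be solved in output-quasipolynomial time.
   Context: All objects are finite. An implication over a set $X$ is an expression $A \to B$ with $A, B \subseteq X$. An implicational base $\Sigma$ over $X$ is a set of implications over $X$. A set $F \subseteq X$ satisfies $\Sigma$ if for every $A \to B \in \Sigma$, $A \subseteq F$ implies $B \subseteq F$. The family $\mathcal{F}$ of all subsets of $X$ satisfying $\Sigma$ is a closure system (it contains $X$ and is closed under intersection); its members are called closed sets, and its closure operator is $\phi(Y) = \bigcap\{F \in \mathcal{F} \mid Y \subseteq F\}$. Write $\phi(x)$ for $\phi(\{x\})$ and $\phi(xy)$ for $\phi(\{x,y\})$. Closure systems are assumed standard: $\phi(\emptyset) = \emptyset$ and $\phi(x) \setminus \{x\}$ is closed for every $x \in X$. $\mathcal{F}$ is atomistic if $\phi(x) = \{x\}$ for every $x \in X$ (so the atoms, i.e. the closed sets covering $\emptyset$, are exactly the singletons). $\mathcal{F}$ is biatomic if for all non-empty closed sets $F_1, F_2 \in \mathcal{F}$ and every atom $\{x\} \in \mathcal{F}$, $x \in \phi(F_1 \cup F_2)$ implies that there exist atoms $\{x_1\} \subseteq F_1$ and $\{x_2\} \subseteq F_2$ such that $x \in \phi(x_1 x_2)$. A minimal generator of $x \in X$ is an inclusion-wise minimal subset $A_x \subseteq X$ such that $x \in \phi(A_x)$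 (in particular $\{x\}$ counts as a trivial minimal generator of $x$). A subset $Y \subseteq X$ is independent if $\phi(Y_1 \cap Y_2) = \phi(Y_1) \cap \phi(Y_2)$ for all $Y_1, Y_2 \subseteq Y$. A consistency-graph over $X$ is a (simple, undirected) graph $G_c = (X, E_c)$; it is non-empty if $E_c \neq \emptyset$. The set $\mathsf{maxCC}(\Sigma, G_c)$ consists of the inclusion-wise maximal members of $\{F \in \mathcal{F} \mid F \text{ is an independent set of the graph } G_c\}$. Problem MCCEnum. Input: an implicational base $\Sigma$ over $X$ (with $X$ part of the input) and a non-empty consistency-graph $G_c = (X, E_c)$. Output: the set $\mathsf{maxCC}(\Sigma, G_c)$. An enumeration algorithm with input $x$ and set of solutions $R(x)$ runs in output-quasipolynomial time if its execution time is bounded by $N^{\mathrm{polylog}(N)}$, where $N = |x| + |R(x)|$ and $|R(x)|$ is the number of solutions. *)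

theory Defs
  imports Complex_Main
begin

section \<open>Closure systems given by implications\<close>

text \<open>An implication \<open>A \<rightarrow> B\<close> is the pair \<open>(A, B)\<close>; the family of closed sets and the closure
  operator are determined by the ground set \<open>X\<close> and the base \<open>\<Sigma>\<close>.\<close>

type_synonym 'a implication = "'a set \<times> 'a set"

definition implicational_base :: "'a set \<Rightarrow> 'a implication set \<Rightarrow> bool" where
  "implicational_base X \<Sigma> \<longleftrightarrow> (\<forall>(A, B) \<in> \<Sigma>. A \<subseteq> X \<and> B \<subseteq> X)"

definition satisfies :: "'a set \<Rightarrow> 'a implication set \<Rightarrow> bool" where
  "satisfies F \<Sigma> \<longleftrightarrow> (\<forall>(A, B) \<in> \<Sigma>. A \<subseteq> F \<longrightarrow> B \<subseteq> F)"

definition closed_sets :: "'a set \<Rightarrow> 'a implication set \<Rightarrow> 'a set set" where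
  "closed_sets X \<Sigma> = {F. F \<subseteq> X \<and> satisfies F \<Sigma>}"

definition cl :: "'a set \<Rightarrow> 'a implication set \<Rightarrow> 'a set \<Rightarrow> 'a set" where
  "cl X \<Sigma> Y = (\<lambda>F. F \<in> closed_sets X \<Sigma>) hull Y"

definition standard :: "'a set \<Rightarrow> 'a implication set \<Rightarrow> bool" where
  "standard X \<Sigma> \<longleftrightarrow> cl X \<Sigma> {} = {} \<and> (\<forall>x\<in>X. cl X \<Sigma> {x} - {x} \<in> closed_sets X \<Sigma>)"

definition atomistic :: "'a set \<Rightarrow> 'a implication set \<Rightarrow> bool" where
  "atomistic X \<Sigma> \<longleftrightarrow> (\<forall>x\<in>X. cl X \<Sigma> {x} = {x})"

text \<open>In a standard closure system the closed sets covering the empty set are exactly the closed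
  singletons, so atoms are quantified over as elements \<open>x\<close> with \<open>{x}\<close> closed.\<close>

definition biatomic :: "'a set \<Rightarrow> 'a implication set \<Rightarrow> bool" where
  "biatomic X \<Sigma> \<longleftrightarrow>
    (\<forall>F1 \<in> closed_sets X \<Sigma>. \<forall>F2 \<in> closed_sets X \<Sigma>. \<forall>x. F1 \<noteq> {} \<longrightarrow> F2 \<noteq> {} \<longrightarrow>
      {x} \<in> closed_sets X \<Sigma> \<longrightarrow> x \<in> cl X \<Sigma> (F1 \<union> F2) \<longrightarrow>
      (\<exists>x1 x2. {x1} \<in> closed_sets X \<Sigma> \<and> {x2} \<in> closed_sets X \<Sigma> \<and>
        {x1} \<subseteq> F1 \<and> {x2} \<subseteq> F2 \<and> x \<in> cl X \<Sigma> {x1, x2}))"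

definition minimal_generator :: "'a set \<Rightarrow> 'a implication set \<Rightarrow> 'a \<Rightarrow> 'a set \<Rightarrow> bool" where
  "minimal_generator X \<Sigma> x A \<longleftrightarrow>
    A \<subseteq> X \<and> x \<in> cl X \<Sigma> A \<and> (\<forall>B. B \<subset> A \<longrightarrow> x \<notin> cl X \<Sigma> B)"

definition independent_set :: "'a set \<Rightarrow> 'a implication set \<Rightarrow> 'a set \<Rightarrow> bool" where
  "independent_set X \<Sigma> Y \<longleftrightarrow> Y \<subseteq> X \<and>
    (\<forall>Y1 Y2. Y1 \<subseteq> Y \<longrightarrow> Y2 \<subseteq> Y \<longrightarrow> cl X \<Sigma> (Y1 \<inter> Y2) = cl X \<Sigma> Y1 \<inter> cl X \<Sigma> Y2)"


section \<open>Maximal consistent closed sets\<close>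

definition simple_graph :: "'a set \<Rightarrow> 'a set set \<Rightarrow> bool" where
  "simple_graph X E \<longleftrightarrow> (\<forall>e\<in>E. e \<subseteq> X \<and> card e = 2)"

definition graph_independent :: "'a set set \<Rightarrow> 'a set \<Rightarrow> bool" where
  "graph_independent E F \<longleftrightarrow> \<not> (\<exists>e\<in>E. e \<subseteq> F)"

type_synonym 'a mcc_input = "'a set \<times> 'a implication set \<times> 'a set set"

definition mcc_input :: "'a mcc_input \<Rightarrow> bool" where
  "mcc_input = (\<lambda>(X, \<Sigma>, E). finite X \<and> implicational_base X \<Sigma> \<and> standard X \<Sigma> \<and>
     simple_graph X E \<and> E \<noteq> {})"

definition maxCC :: "'a mcc_input \<Rightarrow> 'a set set" where
  "maxCC = (\<lambda>(X, \<Sigma>, E).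
     let C = {F \<in> closed_sets X \<Sigma>. graph_independent E F}
     in {F \<in> C. \<forall>F' \<in> C. F \<subseteq> F' \<longrightarrow> F' = F})"


section \<open>Model of computation\<close>

text \<open>Programs are written in a first-order functional language with recursion, whose only data are
  binary trees: a variant of the languages of Jones, \<^emph>\<open>Computability and Complexity from a
  Programming Perspective\<close> (1997). A program is a finite list of function bodies; inside a body,
  variables are de Bruijn indices into the list of arguments extended by the let-bound values.
  Every evaluated expression node costs one time unit. On a heap with sharing each such node takes
  a constant number of pointer operations (no expression compares, copies or measures whole trees),
  so time agrees up to a polynomial with time on random access and Turing machines.\<close>

datatype tree = Leaf | Node tree tree

fun left :: "tree \<Rightarrow> tree" where
  "left Leaf = Leaf"
| "left (Node a b) = a"

fun right :: "tree \<Rightarrow> tree" where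
  "right Leaf = Leaf"
| "right (Node a b) = b"

datatype exp =
    Var nat
  | Nil_exp
  | Cons_exp exp exp
  | Left exp
  | Right exp
  | If_exp exp exp exp
  | Let_exp exp exp
  | Call nat "exp list"

type_synonym program = "exp list"

inductive eval :: "program \<Rightarrow> tree list \<Rightarrow> exp \<Rightarrow> tree \<Rightarrow> nat \<Rightarrow> bool"
  and evals :: "program \<Rightarrow> tree list \<Rightarrow> exp list \<Rightarrow> tree list \<Rightarrow> nat \<Rightarrow> bool"
  for P :: program where
  eval_Var: "i < length env \<Longrightarrow> eval P env (Var i) (env ! i) 1"
| eval_Nil: "eval P env Nil_exp Leaf 1"
| eval_Cons: "eval P env e1 v1 t1 \<Longrightarrow> eval P env e2 v2 t2 \<Longrightarrow>
    eval P env (Cons_exp e1 e2) (Node v1 v2) (1 + t1 + t2)"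
| eval_Left: "eval P env e v t \<Longrightarrow> eval P env (Left e) (left v) (1 + t)"
| eval_Right: "eval P env e v t \<Longrightarrow> eval P env (Right e) (right v) (1 + t)"
| eval_If_true: "eval P env b v0 t0 \<Longrightarrow> v0 \<noteq> Leaf \<Longrightarrow> eval P env e1 v t \<Longrightarrow>
    eval P env (If_exp b e1 e2) v (1 + t0 + t)"
| eval_If_false: "eval P env b Leaf t0 \<Longrightarrow> eval P env e2 v t \<Longrightarrow>
    eval P env (If_exp b e1 e2) v (1 + t0 + t)"
| eval_Let: "eval P env e1 v1 t1 \<Longrightarrow> eval P (v1 # env) e2 v t \<Longrightarrow>
    eval P env (Let_exp e1 e2) v (1 + t1 + t)"
| eval_Call: "evals P env es vs t0 \<Longrightarrow> f < length P \<Longrightarrow> eval P vs (P ! f) v t \<Longrightarrow>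
    eval P env (Call f es) v (1 + t0 + t)"
| evals_Nil: "evals P env [] [] 0"
| evals_Cons: "eval P env e v t1 \<Longrightarrow> evals P env es vs t2 \<Longrightarrow>
    evals P env (e # es) (v # vs) (t1 + t2)"

inductive_cases eval_elims:
  "eval P env (Var i) v t" "eval P env Nil_exp v t" "eval P env (Cons_exp e1 e2) v t"
  "eval P env (Left e) v t" "eval P env (Right e) v t" "eval P env (If_exp b e1 e2) v t"
  "eval P env (Let_exp e1 e2) v t" "eval P env (Call f es) v t"
  "evals P env [] vs t" "evals P env (e # es) vs t"

lemma eval_deterministic:
  shows "eval P env e v t \<Longrightarrow> (\<And>v' t'. eval P env e v' t' \<Longrightarrow> v' = v \<and> t' = t)"
    and "evals P env es vs t \<Longrightarrow> (\<And>vs' t'. evals P env es vs' t' \<Longrightarrow> vs' = vs \<and> t' = t)"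
proof (induction rule: eval_evals.inducts)
  case (eval_Var i env)
  from eval_Var.prems show ?case by (rule eval_elims(1)) simp
next
  case (eval_Nil env)
  from eval_Nil.prems show ?case by (rule eval_elims(2)) simp
next
  case (eval_Cons env e1 v1 t1 e2 v2 t2)
  from eval_Cons.prems show ?case
    by (rule eval_elims(3)) (auto dest: eval_Cons.IH(2,4))
next
  case (eval_Left env e v t)
  from eval_Left.prems show ?case
    by (rule eval_elims(4)) (auto dest: eval_Left.IH(2))
next
  case (eval_Right env e v t)
  from eval_Right.prems show ?case
    by (rule eval_elims(5)) (auto dest: eval_Right.IH(2))
next
  case (eval_If_true env b v0 t0 e1 v t e2)
  from eval_If_true.prems show ?case
    by (rule eval_elims(6)) (use eval_If_true.hyps in \<open>auto dest: eval_If_true.IH(2,4)\<close>)+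
next
  case (eval_If_false env b t0 e2 v t e1)
  from eval_If_false.prems show ?case
    by (rule eval_elims(6)) (auto dest: eval_If_false.IH(2,4))+
next
  case (eval_Let env e1 v1 t1 e2 v t)
  from eval_Let.prems show ?case
    by (rule eval_elims(7)) (auto dest: eval_Let.IH(2,4))
next
  case (eval_Call env es vs t0 f v t)
  from eval_Call.prems show ?case
    by (rule eval_elims(8)) (auto dest: eval_Call.IH(2,5))
next
  case (evals_Nil env)
  from evals_Nil.prems show ?case by (rule eval_elims(9)) simp
next
  case (evals_Cons env e v t1 es vs t2)
  from evals_Cons.prems show ?case
    by (rule eval_elims(10)) (auto dest: evals_Cons.IH(2,4))
qed

text \<open>A computation calls function \<open>0\<close> on the input tree; \<open>t\<close> is its running time. A run that does
  not terminate or refers to a missing variable or function has no result.\<close>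

definition run :: "program \<Rightarrow> tree \<Rightarrow> tree \<Rightarrow> nat \<Rightarrow> bool" where
  "run P v w t \<longleftrightarrow> P \<noteq> [] \<and> eval P [v] (P ! 0) w t"


section \<open>Encodings\<close>

fun tree_size :: "tree \<Rightarrow> nat" where
  "tree_size Leaf = 1"
| "tree_size (Node a b) = 1 + tree_size a + tree_size b"

fun tree_of_list :: "tree list \<Rightarrow> tree" where
  "tree_of_list [] = Leaf"
| "tree_of_list (v # vs) = Node v (tree_of_list vs)"

text \<open>Binary notation, least significant bit first.\<close>

fun tree_of_nat :: "nat \<Rightarrow> tree" where
  "tree_of_nat n = (if n = 0 then Leaf
     else Node (if odd n then Node Leaf Leaf else Leaf) (tree_of_nat (n div 2)))"

declare tree_of_nat.simps [simp del]

text \<open>Encodings of sets are relations between objects and trees, because a set may be listed in any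
  order; every element is listed exactly once.\<close>

definition enc_nat :: "nat \<Rightarrow> tree \<Rightarrow> bool" where
  "enc_nat n v \<longleftrightarrow> v = tree_of_nat n"

definition enc_pair :: "('a \<Rightarrow> tree \<Rightarrow> bool) \<Rightarrow> ('b \<Rightarrow> tree \<Rightarrow> bool) \<Rightarrow> 'a \<times> 'b \<Rightarrow> tree \<Rightarrow> bool" where
  "enc_pair R S p v \<longleftrightarrow> (\<exists>a b. R (fst p) a \<and> S (snd p) b \<and> v = Node a b)"

definition enc_set :: "('a \<Rightarrow> tree \<Rightarrow> bool) \<Rightarrow> 'a set \<Rightarrow> tree \<Rightarrow> bool" where
  "enc_set R A v \<longleftrightarrow>
    (\<exists>xs vs. distinct xs \<and> set xs = A \<and> list_all2 R xs vs \<and> v = tree_of_list vs)"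

text \<open>Elements of the ground set are named by arbitrary natural numbers.\<close>

definition enc_mcc_input :: "nat mcc_input \<Rightarrow> tree \<Rightarrow> bool" where
  "enc_mcc_input =
    enc_pair (enc_set enc_nat)
      (enc_pair (enc_set (enc_pair (enc_set enc_nat) (enc_set enc_nat)))
        (enc_set (enc_set enc_nat)))"


section \<open>Output-quasipolynomial time\<close>

text \<open>The enumeration problem has the inputs \<open>I\<close> and the solution set \<open>R x\<close> for \<open>x \<in> I\<close>. Nothing is
  required of the program on trees that do not encode a member of \<open>I\<close>. The bound is
  \<open>N\<close> to the power \<open>O(log\<^sup>k N)\<close>; lower-order terms are absorbed by \<open>c\<close> as soon as \<open>N \<ge> 2\<close>.\<close>

definition output_quasipolynomial_time ::
  "('i \<Rightarrow> tree \<Rightarrow> bool) \<Rightarrow> ('s \<Rightarrow> tree \<Rightarrow> bool) \<Rightarrow> 'i set \<Rightarrow> ('i \<Rightarrow> 's set) \<Rightarrow> bool" where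
  "output_quasipolynomial_time enc_in enc_out I R \<longleftrightarrow>
    (\<exists>P (c::real) (k::nat). \<forall>x\<in>I. \<forall>v. enc_in x v \<longrightarrow>
      (\<exists>w t. run P v w t \<and> enc_set enc_out (R x) w \<and>
        (let N = real (tree_size v + card (R x))
         in real t \<le> N powr (c * log 2 N ^ k))))"

end

theory Submission
  imports Defs
begin

text \<open>Call a set consistent if its closure contains no edge. Consistency is hereditary, and the
  maximal consistent sets are exactly the members of \<^term>\<open>maxCC\<close>. Let \<open>facets V L\<close> be the maximal
  \<open>S \<subseteq> V\<close> with \<open>S \<union> L\<close> consistent. If \<open>V \<union> L\<close> is consistent, \<open>V\<close> is the only one; otherwise
  \<open>facets (insert v V) L\<close> consists of the maximal sets among the \<open>M\<close> and the \<open>insert v S\<close>, where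
  \<open>M \<in> facets V L\<close> and \<open>S \<in> facets M (insert v L)\<close>. Every facet of a subproblem extends to a solution
  that determines it, so all intermediate lists are at most as long as the output.

  In every recursive call the minimal inconsistent subsets of \<open>V \<union> L\<close> contain \<open>L\<close>, because \<open>M \<union> L\<close>
  is consistent. Hence \<open>L\<close> never outgrows the largest minimal inconsistent set by more than one, and
  this dimension bounds the exponent in the number of calls. It is logarithmic: a minimal inconsistent
  set is covered by minimal generators of the two ends of an edge, and a minimal generator of size \<open>k\<close>
  forces \<open>2 ^ k - 1\<close> distinct elements of the ground set.\<close>

section \<open>Maximal members and hereditary properties\<close>

definition maximal_members :: "'a set set \<Rightarrow> 'a set set" where
  "maximal_members \<S> = {A \<in> \<S>. \<forall>B\<in>\<S>. A \<subseteq> B \<longrightarrow> B = A}"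

lemma maximal_membersI:
  "A \<in> \<S> \<Longrightarrow> (\<And>B. B \<in> \<S> \<Longrightarrow> A \<subseteq> B \<Longrightarrow> B = A) \<Longrightarrow> A \<in> maximal_members \<S>"
  by (simp add: maximal_members_def)

lemma maximal_membersD:
  assumes "A \<in> maximal_members \<S>"
  shows "A \<in> \<S>" and "B \<in> \<S> \<Longrightarrow> A \<subseteq> B \<Longrightarrow> B = A"
  using assms by (simp_all add: maximal_members_def)

text \<open>A maximal member of \<open>\<S>\<close> lies below a member of \<open>\<T>\<close> and
  so equals it; conversely, anything in \<open>\<S>\<close> above a maximal member of
  \<open>\<T>\<close> is squeezed below a further member of \<open>\<T>\<close>. Candidate families
  may thus be thinned out.\<close>

lemma maximal_members_cofinal:
  assumes sub: "\<T> \<subseteq> \<S>" and cofinal: "\<And>A. A \<in> \<S> \<Longrightarrow> \<exists>B\<in>\<T>. A \<subseteq> B"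
  shows "maximal_members \<S> = maximal_members \<T>"
proof (intro equalityI subsetI)
  fix A assume A: "A \<in> maximal_members \<S>"
  obtain B where B: "B \<in> \<T>" "A \<subseteq> B" using cofinal[OF maximal_membersD(1)[OF A]] by blast
  then have "B = A" using maximal_membersD(2)[OF A] sub by blast
  then show "A \<in> maximal_members \<T>"
    using B(1) maximal_membersD(2)[OF A] sub by (intro maximal_membersI) auto
next
  fix A assume A: "A \<in> maximal_members \<T>"
  have "B = A" if B: "B \<in> \<S>" "A \<subseteq> B" for B
  proof -
    obtain C where C: "C \<in> \<T>" "B \<subseteq> C" using cofinal[OF B(1)] by blast
    then have "C = A" using maximal_membersD(2)[OF A C(1)] B(2) by blast
    then show ?thesis using C B(2) by blast
  qed
  then show "A \<in> maximal_members \<S>"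
    using maximal_membersD(1)[OF A] sub by (intro maximal_membersI) auto
qed

lemma exists_maximal_member:
  assumes "finite \<S>" "A \<in> \<S>"
  shows "\<exists>B \<in> maximal_members \<S>. A \<subseteq> B"
  using finite_has_maximal2[OF assms] unfolding maximal_members_def by auto

section \<open>Facets and minimal non-faces of a hereditary property\<close>

locale hereditary_property =
  fixes con :: "'a set \<Rightarrow> bool"
  assumes con_subset: "con T \<Longrightarrow> S \<subseteq> T \<Longrightarrow> con S"
begin

text \<open>For \<open>V\<close> disjoint from \<open>L\<close> these are the facets of the link of
  \<open>L\<close>, restricted to \<open>V\<close>, in the simplicial complex described by
  \<open>con\<close>.\<close>

definition facets :: "'a set \<Rightarrow> 'a set \<Rightarrow> 'a set set" where
  "facets V L = maximal_members {S. S \<subseteq> V \<and> con (S \<union> L)}"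

text \<open>Since \<open>con\<close> is hereditary, deleting single elements tests all proper
  subsets.\<close>

definition minimal_nonmember :: "'a set \<Rightarrow> bool" where
  "minimal_nonmember S \<longleftrightarrow> \<not> con S \<and> (\<forall>x\<in>S. con (S - {x}))"

lemma facetsD:
  assumes "S \<in> facets V L"
  shows "S \<subseteq> V" "con (S \<union> L)"
  using assms unfolding facets_def maximal_members_def by auto

lemma finite_facets: "finite V \<Longrightarrow> finite (facets V L)"
  unfolding facets_def maximal_members_def by (rule finite_subset[of _ "Pow V"]) auto

lemma facet_above:
  assumes "finite V" "S \<subseteq> V" "con (S \<union> L)"
  shows "\<exists>F\<in>facets V L. S \<subseteq> F"
proof -
  have "finite {S. S \<subseteq> V \<and> con (S \<union> L)}" using assms(1) by simp
  then show ?thesis unfolding facets_def using assms exists_maximal_member by blast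
qed

lemma facets_consistent: "con (V \<union> L) \<Longrightarrow> facets V L = {V}"
  unfolding facets_def maximal_members_def by auto

lemma facets_empty_inconsistent: "\<not> con L \<Longrightarrow> facets {} L = {}"
  unfolding facets_def maximal_members_def by auto

text \<open>The sets on the right are cofinal among the consistent ones: \<open>S - {v}\<close>
  extends to a facet \<open>M\<close> of \<open>V\<close>, which contains \<open>S\<close> if
  \<open>v\<close> is not in \<open>S\<close>; otherwise \<open>S - {v}\<close> is also consistent
  with \<open>insert v L\<close> and extends within \<open>M\<close>.\<close>

lemma facets_insert:
  assumes "finite V" "v \<notin> V"
  shows "facets (insert v V) L =
    maximal_members (\<Union>M\<in>facets V L. insert M (insert v ` facets M (insert v L)))"
  unfolding facets_def[of "insert v V"]
proof (rule maximal_members_cofinal)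
  show "(\<Union>M\<in>facets V L. insert M (insert v ` facets M (insert v L)))
      \<subseteq> {S. S \<subseteq> insert v V \<and> con (S \<union> L)}"
    by (auto dest: facetsD)
next
  fix S assume "S \<in> {S. S \<subseteq> insert v V \<and> con (S \<union> L)}"
  then have S: "S \<subseteq> insert v V" "con (S \<union> L)" by auto
  have "con ((S - {v}) \<union> L)" by (rule con_subset[OF S(2)]) auto
  then obtain M where M: "M \<in> facets V L" "S - {v} \<subseteq> M"
    using facet_above[OF assms(1), of "S - {v}" L] S(1) by blast
  show "\<exists>B\<in>\<Union>M\<in>facets V L. insert M (insert v ` facets M (insert v L)). S \<subseteq> B"
  proof (cases "v \<in> S")
    case True
    have "con ((S - {v}) \<union> insert v L)" by (rule con_subset[OF S(2)]) (use True in auto)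
    moreover have "finite M" using facetsD(1)[OF M(1)] assms(1) finite_subset by blast
    ultimately obtain T where "T \<in> facets M (insert v L)" "S - {v} \<subseteq> T"
      using facet_above[of M "S - {v}" "insert v L"] M(2) by blast
    then show ?thesis using M(1) by blast
  next
    case False
    then show ?thesis using M by auto
  qed
qed

text \<open>Extending \<open>S \<union> L\<close> to a facet \<open>G\<close> of \<open>X\<close>
  and cutting back to \<open>V\<close> returns \<open>S\<close>, by maximality of \<open>S\<close>.
  So the traces on \<open>V\<close> of the facets of \<open>X\<close> include every facet of the
  subproblem.\<close>

lemma card_facets_le:
  assumes "finite X" "V \<subseteq> X" "L \<subseteq> X"
  shows "card (facets V L) \<le> card (facets X {})"
proof -
  have "facets V L \<subseteq> (\<lambda>G. G \<inter> V) ` facets X {}"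
  proof
    fix S assume S: "S \<in> facets V L"
    obtain G where G: "G \<in> facets X {}" "S \<union> L \<subseteq> G"
      using facet_above[OF assms(1), of "S \<union> L" "{}"] facetsD[OF S] assms by auto
    have "con ((G \<inter> V) \<union> L)" using facetsD(2)[OF G(1)] by (rule con_subset) (use G(2) in auto)
    then have "G \<inter> V = S"
      using G(2) facetsD(1)[OF S] by (intro maximal_membersD(2)[OF S[unfolded facets_def]]) auto
    then show "S \<in> (\<lambda>G. G \<inter> V) ` facets X {}" using G(1) by blast
  qed
  then show ?thesis using finite_facets[OF assms(1)] by (meson card_mono card_image_le finite_imageI order_trans)
qed

lemma minimal_nonmember_below:
  assumes "finite S" "\<not> con S"
  shows "\<exists>T\<subseteq>S. minimal_nonmember T"
  using assms
proof (induction rule: finite_psubset_induct)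
  case (psubset S)
  show ?case
  proof (cases "minimal_nonmember S")
    case False
    then obtain x where "x \<in> S" "\<not> con (S - {x})" using psubset.prems unfolding minimal_nonmember_def by auto
    then show ?thesis using psubset.IH[of "S - {x}"] by blast
  qed auto
qed

text \<open>A subset of \<open>M \<union> insert v L\<close> that avoids \<open>v\<close> lies in
  the consistent set \<open>M \<union> L\<close>. This carries the invariant on \<open>L\<close>
  over to the branch that adds \<open>v\<close> to \<open>L\<close>.\<close>

lemma minimal_nonmembers_contain_insert:
  assumes "M \<in> facets V L"
    and "\<And>F. minimal_nonmember F \<Longrightarrow> F \<subseteq> insert v V \<union> L \<Longrightarrow> L \<subseteq> F"
    and "minimal_nonmember F" "F \<subseteq> M \<union> insert v L"
  shows "insert v L \<subseteq> F"
proof -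
  have "v \<in> F"
  proof (rule ccontr)
    assume "v \<notin> F"
    then have "F \<subseteq> M \<union> L" using assms(4) by auto
    then show False
      using con_subset[OF facetsD(2)[OF assms(1)]] assms(3) unfolding minimal_nonmember_def by blast
  qed
  moreover have "L \<subseteq> F" using assms(2)[OF assms(3)] assms(4) facetsD(1)[OF assms(1)] by blast
  ultimately show ?thesis by simp
qed

end

section \<open>Closure systems with independent minimal generators\<close>

lemma cl_mono: "Y \<subseteq> Z \<Longrightarrow> cl X \<Sigma> Y \<subseteq> cl X \<Sigma> Z"
  unfolding cl_def by (rule hull_mono)

lemma cl_extensive: "Y \<subseteq> cl X \<Sigma> Y"
  unfolding cl_def by (rule hull_subset)

lemma cl_least: "Y \<subseteq> F \<Longrightarrow> F \<in> closed_sets X \<Sigma> \<Longrightarrow> cl X \<Sigma> Y \<subseteq> F"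
  unfolding cl_def by (rule hull_minimal)

lemma cl_closed:
  assumes "implicational_base X \<Sigma>" "Y \<subseteq> X"
  shows "cl X \<Sigma> Y \<in> closed_sets X \<Sigma>"
proof -
  have "X \<in> closed_sets X \<Sigma>"
    using assms(1) unfolding closed_sets_def satisfies_def implicational_base_def by auto
  then have "cl X \<Sigma> Y \<subseteq> X" using cl_least assms(2) by blast
  moreover have "B \<subseteq> cl X \<Sigma> Y" if "(A, B) \<in> \<Sigma>" "A \<subseteq> cl X \<Sigma> Y" for A B
  proof -
    have "B \<subseteq> F" if F: "Y \<subseteq> F" "F \<in> closed_sets X \<Sigma>" for F
      using cl_least[OF F] F(2) \<open>A \<subseteq> cl X \<Sigma> Y\<close> \<open>(A, B) \<in> \<Sigma>\<close>
      unfolding closed_sets_def satisfies_def by blast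
    then show ?thesis unfolding cl_def hull_def by blast
  qed
  ultimately show ?thesis unfolding closed_sets_def satisfies_def by blast
qed

lemma minimal_generator_below:
  assumes "finite Y" "Y \<subseteq> X" "x \<in> cl X \<Sigma> Y"
  shows "\<exists>A\<subseteq>Y. minimal_generator X \<Sigma> x A"
  using assms
proof (induction rule: finite_psubset_induct)
  case (psubset Y)
  show ?case
  proof (cases "minimal_generator X \<Sigma> x Y")
    case False
    then obtain B where "B \<subset> Y" "x \<in> cl X \<Sigma> B"
      using psubset.prems unfolding minimal_generator_def by auto
    then show ?thesis using psubset.IH[of B] psubset.prems(1) by blast
  qed auto
qed

text \<open>Biatomicity splits \<open>x\<close> along every bipartition of a minimal generator \<open>A\<close>, so each non-empty
  part \<open>B\<close> is a minimal generator of some element; independence makes these elements distinct.\<close>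

lemma minimal_generator_card:
  assumes fin: "finite X" and base: "implicational_base X \<Sigma>"
    and biat: "biatomic X \<Sigma>" and atom: "atomistic X \<Sigma>"
    and x: "x \<in> X" and gen: "minimal_generator X \<Sigma> x A" and indep: "independent_set X \<Sigma> A"
  shows "2 ^ card A \<le> card X + 1"
proof -
  let ?cl = "cl X \<Sigma>"
  have AX: "A \<subseteq> X" and xA: "x \<in> ?cl A" and min: "\<And>B. B \<subset> A \<Longrightarrow> x \<notin> ?cl B"
    using gen unfolding minimal_generator_def by auto
  have closed: "?cl B \<in> closed_sets X \<Sigma>" if "B \<subseteq> A" for B
    using cl_closed[OF base] that AX by auto
  have "\<exists>y\<in>X. y \<in> ?cl B \<and> (\<forall>C. C \<subset> B \<longrightarrow> y \<notin> ?cl C)" if B: "B \<subseteq> A" "B \<noteq> {}" for B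
  proof (cases "B = A")
    case True
    then show ?thesis using xA min x by auto
  next
    case False
    then have AB: "A - B \<noteq> {}" using B by auto
    have "A \<subseteq> ?cl B \<union> ?cl (A - B)" using cl_extensive[of B X \<Sigma>] cl_extensive[of "A - B" X \<Sigma>] by blast
    then have "x \<in> ?cl (?cl B \<union> ?cl (A - B))" using xA cl_mono[THEN subsetD] by metis
    moreover have "?cl B \<noteq> {}" "?cl (A - B) \<noteq> {}"
      using B AB cl_extensive[of B X \<Sigma>] cl_extensive[of "A - B" X \<Sigma>] by auto
    moreover have "{x} \<in> closed_sets X \<Sigma>"
      using cl_closed[OF base, of "{x}"] atom x unfolding atomistic_def by simp
    ultimately have "\<exists>y z. {y} \<in> closed_sets X \<Sigma> \<and> {z} \<in> closed_sets X \<Sigma> \<and>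
        {y} \<subseteq> ?cl B \<and> {z} \<subseteq> ?cl (A - B) \<and> x \<in> ?cl {y, z}"
      using biat[unfolded biatomic_def, rule_format, OF closed[OF B(1)] closed[OF Diff_subset]]
      by blast
    then obtain y z where yz: "y \<in> ?cl B" "z \<in> ?cl (A - B)" "x \<in> ?cl {y, z}"
      by blast
    \<comment> \<open>Otherwise \<open>C \<union> (A - B)\<close>, a proper subset of
      \<open>A\<close>, would generate \<open>y\<close> and \<open>z\<close> and hence
      \<open>x\<close>.\<close>
    have "y \<notin> ?cl C" if C: "C \<subset> B" for C
    proof
      assume "y \<in> ?cl C"
      have D: "C \<union> (A - B) \<subset> A" using C B by auto
      have "{y, z} \<subseteq> ?cl (C \<union> (A - B))"
        using \<open>y \<in> ?cl C\<close> yz(2) cl_mono[OF Un_upper1, of X \<Sigma> C "A - B"]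
          cl_mono[OF Un_upper2, of X \<Sigma> "A - B" C] by auto
      then have "?cl {y, z} \<subseteq> ?cl (C \<union> (A - B))"
        by (rule cl_least) (use D closed in auto)
      then show False using yz(3) min[OF D] by blast
    qed
    then show ?thesis using yz(1) closed[OF B(1)] unfolding closed_sets_def by auto
  qed
  then have "\<forall>B\<in>Pow A - {{}}. \<exists>y. y \<in> X \<and> y \<in> ?cl B \<and> (\<forall>C. C \<subset> B \<longrightarrow> y \<notin> ?cl C)"
    by (simp add: Bex_def)
  from bchoice[OF this] obtain f where
    "\<forall>B\<in>Pow A - {{}}. f B \<in> X \<and> f B \<in> ?cl B \<and> (\<forall>C. C \<subset> B \<longrightarrow> f B \<notin> ?cl C)" ..
  then have f: "f B \<in> X" "f B \<in> ?cl B" "C \<subset> B \<Longrightarrow> f B \<notin> ?cl C" if "B \<in> Pow A - {{}}" for B C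
    using that by simp_all
  have "inj_on f (Pow A - {{}})"
  proof (rule inj_onI)
    fix B C assume BC: "B \<in> Pow A - {{}}" "C \<in> Pow A - {{}}" "f B = f C"
    \<comment> \<open>Independence puts the common value into the closure of
      \<open>B \<inter> C\<close>; by minimality this intersection is proper in neither
      \<open>B\<close> nor \<open>C\<close>.\<close>
    have "?cl (B \<inter> C) = ?cl B \<inter> ?cl C" using indep BC(1,2) unfolding independent_set_def by simp
    then have "f B \<in> ?cl (B \<inter> C)" using f(2)[OF BC(1)] f(2)[OF BC(2)] BC(3) by simp
    then have "\<not> B \<inter> C \<subset> B" "\<not> B \<inter> C \<subset> C"
      using f(3)[OF BC(1)] f(3)[OF BC(2)] BC(3) by auto
    then show "B = C" by blast
  qed
  then have "card (Pow A - {{}}) \<le> card X"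
    by (rule card_inj_on_le) (use f fin in auto)
  moreover have "finite A" using AX fin finite_subset by blast
  ultimately show ?thesis by (simp add: card_Pow)
qed

section \<open>Consistent sets and their logarithmic dimension\<close>

definition consistent :: "'a set \<Rightarrow> 'a implication set \<Rightarrow> 'a set set \<Rightarrow> 'a set \<Rightarrow> bool" where
  "consistent X \<Sigma> E S \<longleftrightarrow> graph_independent E (cl X \<Sigma> S)"

interpretation consistent: hereditary_property "consistent X \<Sigma> E" for X \<Sigma> E
proof
  fix S T assume "consistent X \<Sigma> E T" "S \<subseteq> T"
  then show "consistent X \<Sigma> E S"
    using cl_mono[of S T X \<Sigma>] unfolding consistent_def graph_independent_def by blast
qed

text \<open>Closed consistent sets are cofinal among all consistent sets, since the closure of a
  consistent set is consistent; on closed sets consistency is independence in the graph.\<close>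

lemma maxCC_eq_facets:
  assumes "implicational_base X \<Sigma>"
  shows "maxCC (X, \<Sigma>, E) = consistent.facets X \<Sigma> E X {}"
proof -
  have cl: "cl X \<Sigma> F = F" if "F \<in> closed_sets X \<Sigma>" for F
    using cl_least[OF subset_refl that] cl_extensive[of F X \<Sigma>] by (rule subset_antisym)
  have "maxCC (X, \<Sigma>, E) = maximal_members {F \<in> closed_sets X \<Sigma>. graph_independent E F}"
    by (simp add: maxCC_def maximal_members_def Let_def)
  also have "\<dots> = consistent.facets X \<Sigma> E X {}"
    unfolding consistent.facets_def
  proof (rule maximal_members_cofinal[symmetric])
    show "{F \<in> closed_sets X \<Sigma>. graph_independent E F} \<subseteq> {S. S \<subseteq> X \<and> consistent X \<Sigma> E (S \<union> {})}"
      using cl unfolding consistent_def by (auto simp: closed_sets_def)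
  next
    fix S assume "S \<in> {S. S \<subseteq> X \<and> consistent X \<Sigma> E (S \<union> {})}"
    then have "S \<subseteq> X" "graph_independent E (cl X \<Sigma> S)" by (simp_all add: consistent_def)
    then show "\<exists>F\<in>{F \<in> closed_sets X \<Sigma>. graph_independent E F}. S \<subseteq> F"
      using cl_closed[OF assms] cl_extensive[of S X \<Sigma>] by (intro bexI[of _ "cl X \<Sigma> S"]) simp_all
  qed
  finally show ?thesis .
qed

text \<open>If the edge \<open>{u, w}\<close> lies in the closure of \<open>F\<close>, minimal
  generators \<open>A\<close> of \<open>u\<close> and \<open>B\<close> of \<open>w\<close> inside
  \<open>F\<close> already have an inconsistent union, so \<open>F = A \<union> B\<close> by
  minimality. Multiplying the bounds for \<open>A\<close> and \<open>B\<close> gives the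
  square.\<close>

lemma minimal_inconsistent_card:
  assumes fin: "finite X" and base: "implicational_base X \<Sigma>" and graph: "simple_graph X E"
    and biat: "biatomic X \<Sigma>" and atom: "atomistic X \<Sigma>"
    and indep: "\<And>x A. x \<in> X \<Longrightarrow> minimal_generator X \<Sigma> x A \<Longrightarrow> independent_set X \<Sigma> A"
    and FX: "F \<subseteq> X" and F: "consistent.minimal_nonmember X \<Sigma> E F"
  shows "2 ^ card F \<le> (card X + 1)\<^sup>2"
proof -
  obtain e where e: "e \<in> E" "e \<subseteq> cl X \<Sigma> F"
    using F unfolding consistent.minimal_nonmember_def consistent_def graph_independent_def by auto
  then obtain u w where uw: "e = {u, w}" "u \<in> X" "w \<in> X"
    using graph e(1) unfolding simple_graph_def by (auto simp: card_2_iff)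
  have finF: "finite F" using FX fin finite_subset by blast
  obtain A B where AB: "A \<subseteq> F" "minimal_generator X \<Sigma> u A" "B \<subseteq> F" "minimal_generator X \<Sigma> w B"
    using minimal_generator_below[OF finF FX, of u \<Sigma>] minimal_generator_below[OF finF FX, of w \<Sigma>]
      e(2) uw(1) by auto
  have "u \<in> cl X \<Sigma> A" "w \<in> cl X \<Sigma> B" using AB unfolding minimal_generator_def by auto
  then have "e \<subseteq> cl X \<Sigma> (A \<union> B)"
    using cl_mono[OF Un_upper1, of X \<Sigma> A B] cl_mono[OF Un_upper2, of X \<Sigma> B A] unfolding uw by auto
  then have inc: "\<not> consistent X \<Sigma> E (A \<union> B)"
    using e(1) unfolding consistent_def graph_independent_def by blast
  have "F \<subseteq> A \<union> B"
  proof (rule ccontr)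
    assume "\<not> F \<subseteq> A \<union> B"
    then obtain y where "y \<in> F" "y \<notin> A \<union> B" by blast
    then have "A \<union> B \<subseteq> F - {y}" using AB(1,3) by auto
    then show False
      using \<open>y \<in> F\<close> F inc consistent.con_subset[of X \<Sigma> E "F - {y}" "A \<union> B"]
      unfolding consistent.minimal_nonmember_def by simp
  qed
  then have "card F \<le> card (A \<union> B)" using AB finF by (intro card_mono) (auto intro: finite_subset)
  also have "\<dots> \<le> card A + card B" by (rule card_Un_le)
  finally have "(2::nat) ^ card F \<le> 2 ^ (card A + card B)" by (rule power_increasing) simp
  also have "\<dots> \<le> (card X + 1) * (card X + 1)"
    unfolding power_add
    by (rule mult_mono)
      (use minimal_generator_card[OF fin base biat atom uw(2) AB(2) indep[OF uw(2) AB(2)]]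
        minimal_generator_card[OF fin base biat atom uw(3) AB(4) indep[OF uw(3) AB(4)]] in auto)
  finally show ?thesis by (simp add: power2_eq_square)
qed

section \<open>Time-bounded evaluation\<close>

text \<open>Only an upper bound on the time is recorded, so that costs of subterms can be added and
  rounded up.\<close>

definition computes :: "program \<Rightarrow> tree list \<Rightarrow> exp \<Rightarrow> tree \<Rightarrow> nat \<Rightarrow> bool" where
  "computes P env e v T \<longleftrightarrow> (\<exists>t\<le>T. eval P env e v t)"

definition computes_list :: "program \<Rightarrow> tree list \<Rightarrow> exp list \<Rightarrow> tree list \<Rightarrow> nat \<Rightarrow> bool" where
  "computes_list P env es vs T \<longleftrightarrow> (\<exists>t\<le>T. evals P env es vs t)"

definition bool_tree :: "bool \<Rightarrow> tree" where
  "bool_tree b = (if b then Node Leaf Leaf else Leaf)"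

lemma computes_weaken:
  "computes P env e v' T' \<Longrightarrow> v' = v \<Longrightarrow> T' \<le> T \<Longrightarrow> computes P env e v T"
  unfolding computes_def using order_trans by blast

lemma computes_Var:
  "computes P (a # env) (Var 0) a 1"
  "computes P (a # b # env) (Var 1) b 1"
  "computes P (a # b # c # env) (Var 2) c 1"
  "computes P (a # b # c # d # env) (Var 3) d 1"
  using eval_Var[of 0 "a # env"] eval_Var[of 1 "a # b # env"]
    eval_Var[of 2 "a # b # c # env"] eval_Var[of 3 "a # b # c # d # env"]
  unfolding computes_def by (auto simp: numeral_2_eq_2 numeral_3_eq_3)

lemma computes_Nil: "computes P env Nil_exp Leaf 1"
  unfolding computes_def using eval_Nil by blast

lemma computes_true: "computes P env (Cons_exp Nil_exp Nil_exp) (bool_tree True) 3"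
  unfolding computes_def bool_tree_def using eval_Cons[OF eval_Nil eval_Nil, of P env]
  by (auto simp: eval_nat_numeral)

lemma computes_false: "computes P env Nil_exp (bool_tree False) 1"
  unfolding bool_tree_def using computes_Nil by simp

lemma computes_Cons:
  assumes "computes P env e1 v1 t1" "computes P env e2 v2 t2"
  shows "computes P env (Cons_exp e1 e2) (Node v1 v2) (1 + t1 + t2)"
  using assms eval_Cons unfolding computes_def by (meson add_le_mono order_refl)

lemma computes_Left:
  assumes "computes P env e (Node a b) t"
  shows "computes P env (Left e) a (1 + t)"
  using assms eval_Left[of P env e "Node a b"] unfolding computes_def by fastforce

lemma computes_Right:
  assumes "computes P env e (Node a b) t"
  shows "computes P env (Right e) b (1 + t)"
  using assms eval_Right[of P env e "Node a b"] unfolding computes_def by fastforce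

lemma computes_If_Node:
  assumes "computes P env (Var i) (Node a b) t0" "computes P env e1 v t"
  shows "computes P env (If_exp (Var i) e1 e2) v (1 + t0 + t)"
proof -
  obtain s0 s where "s0 \<le> t0" "eval P env (Var i) (Node a b) s0" "s \<le> t" "eval P env e1 v s"
    using assms unfolding computes_def by auto
  then show ?thesis
    using eval_If_true[of P env "Var i"] unfolding computes_def
    by (intro exI[of _ "1 + s0 + s"]) auto
qed

lemma computes_If_Leaf:
  assumes "computes P env (Var i) Leaf t0" "computes P env e2 v t"
  shows "computes P env (If_exp (Var i) e1 e2) v (1 + t0 + t)"
proof -
  obtain s0 s where "s0 \<le> t0" "eval P env (Var i) (Leaf) s0" "s \<le> t" "eval P env e2 v s"
    using assms unfolding computes_def by auto
  then show ?thesis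
    using eval_If_false[of P env "Var i"] unfolding computes_def
    by (intro exI[of _ "1 + s0 + s"]) auto
qed

text \<open>The conditional stays in the value and the branch times are merged by
  \<open>max\<close>, so evaluation needs no case distinction; each branch is evaluated under its
  own condition.\<close>

lemma computes_If_bool:
  assumes "computes P env (Call f es) (bool_tree c) t0"
    and "c \<Longrightarrow> computes P env e1 v1 t1" and "\<not> c \<Longrightarrow> computes P env e2 v2 t2"
  shows "computes P env (If_exp (Call f es) e1 e2) (if c then v1 else v2) (1 + t0 + max t1 t2)"
proof (cases c)
  case True
  obtain s0 s1 where "s0 \<le> t0" "eval P env (Call f es) (Node Leaf Leaf) s0"
    "s1 \<le> t1" "eval P env e1 v1 s1"
    using assms(1) assms(2)[OF True] True unfolding computes_def bool_tree_def by auto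
  then show ?thesis
    using True eval_If_true[of P env "Call f es" "Node Leaf Leaf" s0 e1 v1 s1 e2]
    unfolding computes_def by (intro exI[of _ "1 + s0 + s1"]) auto
next
  case False
  obtain s0 s1 where "s0 \<le> t0" "eval P env (Call f es) Leaf s0"
    "s1 \<le> t2" "eval P env e2 v2 s1"
    using assms(1) assms(3)[OF False] False unfolding computes_def bool_tree_def by auto
  then show ?thesis
    using False eval_If_false[of P env "Call f es" s0 e2 v2 s1 e1]
    unfolding computes_def by (intro exI[of _ "1 + s0 + s1"]) auto
qed

lemma computes_list_Nil: "computes_list P env [] [] 0"
  unfolding computes_list_def using evals_Nil by blast

lemma computes_list_Cons:
  assumes "computes P env e v t1" "computes_list P env es vs t2"
  shows "computes_list P env (e # es) (v # vs) (t1 + t2)"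
  using assms evals_Cons unfolding computes_def computes_list_def by (meson add_le_mono)

lemma computes_Call:
  assumes "computes_list P env es vs t0" "f < length P" "computes P vs (P ! f) v t"
  shows "computes P env (Call f es) v (1 + t0 + t)"
  using assms eval_Call[of P env es vs _ f v] unfolding computes_def computes_list_def
  by (meson add_le_mono order_refl)

section \<open>The program\<close>

definition equal_body :: exp where
  "equal_body =
    If_exp (Var 0)
      (If_exp (Var 1)
        (If_exp (Call 1 [Left (Var 0), Left (Var 1)])
          (Call 1 [Right (Var 0), Right (Var 1)]) Nil_exp)
        Nil_exp)
      (If_exp (Var 1) Nil_exp (Cons_exp Nil_exp Nil_exp))"

definition member_body :: exp where
  "member_body =
    If_exp (Var 1)
      (If_exp (Call 1 [Left (Var 1), Var 0])
        (Cons_exp Nil_exp Nil_exp) (Call 2 [Var 0, Right (Var 1)]))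
      Nil_exp"

definition subset_body :: exp where
  "subset_body =
    If_exp (Var 0)
      (If_exp (Call 2 [Left (Var 0), Var 1])
        (Call 3 [Right (Var 0), Var 1]) Nil_exp)
      (Cons_exp Nil_exp Nil_exp)"

definition append_body :: exp where
  "append_body =
    If_exp (Var 0) (Cons_exp (Left (Var 0)) (Call 4 [Right (Var 0), Var 1])) (Var 1)"

definition forward_body :: exp where
  "forward_body =
    If_exp (Var 0)
      (Call 5 [Right (Var 0),
        If_exp (Call 3 [Left (Left (Var 0)), Var 1])
          (Call 4 [Right (Left (Var 0)), Var 1]) (Var 1)])
      (Var 1)"

text \<open>The first argument is a counter: its length is the number of passes, and its entries are
  never read.\<close>

definition saturate_body :: exp where
  "saturate_body =
    If_exp (Var 0) (Call 6 [Right (Var 0), Var 1, Call 5 [Var 1, Var 2]]) (Var 2)"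

definition some_subset_body :: exp where
  "some_subset_body =
    If_exp (Var 0)
      (If_exp (Call 3 [Left (Var 0), Var 1])
        (Cons_exp Nil_exp Nil_exp) (Call 7 [Right (Var 0), Var 1]))
      Nil_exp"

definition some_superset_body :: exp where
  "some_superset_body =
    If_exp (Var 1)
      (If_exp (Call 3 [Var 0, Left (Var 1)])
        (Cons_exp Nil_exp Nil_exp) (Call 8 [Var 0, Right (Var 1)]))
      Nil_exp"

definition maximize_body :: exp where
  "maximize_body =
    If_exp (Var 1)
      (If_exp (Call 8 [Left (Var 1), Right (Var 1)])
        (Call 9 [Var 0, Right (Var 1)])
        (If_exp (Call 8 [Left (Var 1), Var 0])
          (Call 9 [Var 0, Right (Var 1)])
          (Call 9 [Cons_exp (Left (Var 1)) (Var 0), Right (Var 1)])))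
      (Var 0)"

definition insert_all_body :: exp where
  "insert_all_body =
    If_exp (Var 1)
      (Cons_exp (Cons_exp (Var 0) (Left (Var 1))) (Call 10 [Var 0, Right (Var 1), Var 2]))
      (Var 2)"

text \<open>Argument 0 is the whole input, from which the ground set, the base and the edges are
  read; arguments 1 and 2 are \<open>V\<close> and \<open>L\<close>. If \<open>V\<close> is empty
  and \<open>L\<close> inconsistent, there are no facets.\<close>

definition facets_body :: exp where
  "facets_body =
    If_exp (Call 7 [Right (Right (Var 0)),
        Call 6 [Left (Var 0), Left (Right (Var 0)), Call 4 [Var 1, Var 2]]])
      (If_exp (Var 1)
        (Call 9 [Nil_exp, Call 12 [Var 0, Left (Var 1), Var 2, Call 11 [Var 0, Right (Var 1), Var 2]]])
        Nil_exp)
      (Cons_exp (Var 1) Nil_exp)"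

text \<open>Each facet \<open>M\<close> listed in argument 3 contributes itself and, with
  \<open>v\<close> from argument 1 prefixed, the facets of \<open>M\<close> relative to
  \<open>insert v L\<close>.\<close>

definition candidates_body :: exp where
  "candidates_body =
    If_exp (Var 3)
      (Cons_exp (Left (Var 3))
        (Call 10 [Var 1, Call 11 [Var 0, Left (Var 3), Cons_exp (Var 1) (Var 2)],
          Call 12 [Var 0, Var 1, Var 2, Right (Var 3)]]))
      Nil_exp"

definition mcc_program :: program where
  "mcc_program = [Call 11 [Var 0, Left (Var 0), Nil_exp], equal_body, member_body, subset_body,
    append_body, forward_body, saturate_body, some_subset_body, some_superset_body, maximize_body,
    insert_all_body, facets_body, candidates_body]"

lemma length_mcc_program: "length mcc_program = 13"
  unfolding mcc_program_def by simp

lemma mcc_program_nth: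
  "mcc_program ! 0 = Call 11 [Var 0, Left (Var 0), Nil_exp]"
  "mcc_program ! 1 = equal_body" "mcc_program ! 2 = member_body" "mcc_program ! 3 = subset_body"
  "mcc_program ! 4 = append_body" "mcc_program ! 5 = forward_body"
  "mcc_program ! 6 = saturate_body" "mcc_program ! 7 = some_subset_body"
  "mcc_program ! 8 = some_superset_body" "mcc_program ! 9 = maximize_body"
  "mcc_program ! 10 = insert_all_body" "mcc_program ! 11 = facets_body"
  "mcc_program ! 12 = candidates_body"
  unfolding mcc_program_def by simp_all

section \<open>Running times of the set operations\<close>

abbreviation calls :: "nat \<Rightarrow> tree list \<Rightarrow> tree \<Rightarrow> nat \<Rightarrow> bool" where
  "calls f vs v T \<equiv> computes mcc_program vs (mcc_program ! f) v T"

lemma computes_mcc_Call: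
  assumes "computes_list mcc_program env es vs t0" "f < 13" "calls f vs v t"
  shows "computes mcc_program env (Call f es) v (1 + t0 + t)"
  using computes_Call[of mcc_program env es vs t0 f v t] assms by (simp add: length_mcc_program)

lemma function_index_bounds:
  "(1::nat) < 13" "(2::nat) < 13" "(3::nat) < 13" "(4::nat) < 13" "(5::nat) < 13" "(6::nat) < 13"
  "(7::nat) < 13" "(8::nat) < 13" "(9::nat) < 13" "(10::nat) < 13" "(11::nat) < 13" "(12::nat) < 13"
  by simp_all

lemmas computes_rules = computes_Var computes_Left computes_Right computes_If_Node computes_If_Leaf
  computes_If_bool computes_Cons computes_list_Cons computes_list_Nil
  computes_mcc_Call function_index_bounds

text \<open>Each node of \<open>a\<close> is visited at most once, and a call on two nodes costs at
  most 15 apart from its recursive calls.\<close>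

lemma computes_equal: "calls 1 [a, b] (bool_tree (a = b)) (15 * tree_size a)"
proof (induction a arbitrary: b)
  case Leaf
  show ?case
  proof (cases b)
    case Leaf
    show ?thesis
      unfolding mcc_program_nth equal_body_def Leaf
      by (rule computes_weaken, (rule computes_rules computes_true)+) simp_all
  next
    case (Node b1 b2)
    show ?thesis
      unfolding mcc_program_nth equal_body_def Node
      by (rule computes_weaken, (rule computes_rules computes_false)+) simp_all
  qed
next
  case (Node a1 a2)
  show ?case
  proof (cases b)
    case Leaf
    show ?thesis
      unfolding mcc_program_nth equal_body_def Leaf
      by (rule computes_weaken, (rule computes_rules computes_false)+) simp_all
  next
    case b: (Node b1 b2)
    show ?thesis
      unfolding mcc_program_nth(2) equal_body_def b
      by (rule computes_weaken, (rule computes_rules computes_false Node.IH)+) (simp_all add: bool_tree_def)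
  qed
qed


lemma tree_of_nat_eq_iff [simp]: "tree_of_nat m = tree_of_nat n \<longleftrightarrow> m = n"
proof (induction m arbitrary: n rule: less_induct)
  case (less m)
  show ?case
  proof (cases "m = 0 \<or> n = 0")
    case True
    then show ?thesis by (auto simp: tree_of_nat.simps[of m] tree_of_nat.simps[of n])
  next
    case False
    then have "tree_of_nat m = tree_of_nat n \<longleftrightarrow> odd m = odd n \<and> m div 2 = n div 2"
      using less.IH[of "m div 2" "n div 2"]
      by (auto simp: tree_of_nat.simps[of m] tree_of_nat.simps[of n])
    also have "\<dots> \<longleftrightarrow> m = n"
      by (metis odd_two_times_div_two_succ even_two_times_div_two)
    finally show ?thesis .
  qed
qed

lemma tree_size_ge_1: "1 \<le> tree_size v"
  by (cases v) simp_all

abbreviation set_tree :: "nat list \<Rightarrow> tree" where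
  "set_tree xs \<equiv> tree_of_list (map tree_of_nat xs)"

abbreviation family_tree :: "nat list list \<Rightarrow> tree" where
  "family_tree Ss \<equiv> tree_of_list (map set_tree Ss)"

abbreviation base_tree :: "(nat list \<times> nat list) list \<Rightarrow> tree" where
  "base_tree \<Gamma> \<equiv> tree_of_list (map (\<lambda>(A, B). Node (set_tree A) (set_tree B)) \<Gamma>)"

lemmas unfold_trees = list.map tree_of_list.simps prod.case

text \<open>The list entry is the first argument of the comparison, whose cost depends on that
  argument only; the comparisons add up to a multiple of the size of the list, however large
  \<open>x\<close> is.\<close>

lemma computes_member:
  "calls 2 [tree_of_nat x, set_tree ys] (bool_tree (x \<in> set ys)) (25 * tree_size (set_tree ys))"
proof (induction ys)
  case Nil
  show ?case
    unfolding mcc_program_nth member_body_def unfold_trees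
    by (rule computes_weaken, (rule computes_rules computes_false)+) simp_all
next
  case (Cons y ys)
  show ?case
    unfolding mcc_program_nth(3) member_body_def unfold_trees
    by (rule computes_weaken, (rule computes_rules computes_true computes_equal Cons.IH)+) auto
qed

lemma computes_subset:
  "calls 3 [set_tree xs, set_tree ys] (bool_tree (set xs \<subseteq> set ys))
    (40 * tree_size (set_tree xs) * tree_size (set_tree ys))"
proof (induction xs)
  case Nil
  show ?case
    unfolding mcc_program_nth subset_body_def unfold_trees
    by (rule computes_weaken, (rule computes_rules computes_true)+)
      (use tree_size_ge_1[of "set_tree ys"] in simp_all)
next
  case (Cons x xs)
  have time: "11 + 25 * tree_size (set_tree ys) + 40 * tree_size (set_tree xs) * tree_size (set_tree ys)
      \<le> 40 * tree_size (set_tree (x # xs)) * tree_size (set_tree ys)"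
    using tree_size_ge_1[of "set_tree ys"] by (simp add: algebra_simps)
  show ?case
    unfolding mcc_program_nth(4) subset_body_def unfold_trees
    by (rule computes_weaken, (rule computes_rules computes_false computes_member Cons.IH)+)
      (use time in auto)
qed

lemma computes_append:
  "calls 4 [set_tree xs, set_tree ys] (set_tree (xs @ ys)) (10 * tree_size (set_tree xs))"
proof (induction xs)
  case Nil
  show ?case
    unfolding mcc_program_nth append_body_def unfold_trees
    by (rule computes_weaken, (rule computes_rules)+) simp_all
next
  case (Cons x xs)
  show ?case
    unfolding mcc_program_nth(5) append_body_def unfold_trees
    by (rule computes_weaken, (rule computes_rules Cons.IH)+) simp_all
qed

section \<open>Forward chaining and saturation\<close>

fun forward :: "('a list \<times> 'a list) list \<Rightarrow> 'a list \<Rightarrow> 'a list" where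
  "forward [] S = S"
| "forward ((A, B) # \<Gamma>) S = forward \<Gamma> (if set A \<subseteq> set S then B @ S else S)"

fun saturate :: "'b list \<Rightarrow> ('a list \<times> 'a list) list \<Rightarrow> 'a list \<Rightarrow> 'a list" where
  "saturate [] \<Gamma> S = S"
| "saturate (x # xs) \<Gamma> S = saturate xs \<Gamma> (forward \<Gamma> S)"

lemma tree_size_set_tree_append:
  "tree_size (set_tree (xs @ ys)) + 1 = tree_size (set_tree xs) + tree_size (set_tree ys)"
  by (induction xs) auto

text \<open>In one pass every implication fires at most once, so the appended conclusions together
  are no larger than the base. Repetitions are kept; this additive growth keeps the lists small over
  many passes.\<close>

lemma tree_size_forward:
  "tree_size (set_tree (forward \<Gamma> S)) \<le> tree_size (set_tree S) + tree_size (base_tree \<Gamma>)"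
proof (induction \<Gamma> S rule: forward.induct)
  case (2 A B \<Gamma> S)
  then show ?case using tree_size_set_tree_append[of B S] by (auto split: if_splits)
qed simp

text \<open>Throughout a pass the current set is at most as large as \<open>S\<close> and the base
  together, and testing a premise costs a multiple of the product of the sizes.\<close>

lemma computes_forward:
  "calls 5 [base_tree \<Gamma>, set_tree S] (set_tree (forward \<Gamma> S))
    (60 * tree_size (base_tree \<Gamma>) * (tree_size (set_tree S) + tree_size (base_tree \<Gamma>)))"
proof (induction \<Gamma> S rule: forward.induct)
  case (1 S)
  show ?case
    unfolding mcc_program_nth forward_body_def unfold_trees
    by (rule computes_weaken, (rule computes_rules)+) simp_all
next
  case (2 A B \<Gamma> S)
  let ?S = "if set A \<subseteq> set S then B @ S else S"
  define a b g m s where "a = tree_size (set_tree A)" and "b = tree_size (set_tree B)"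
    and "g = tree_size (base_tree \<Gamma>)" and "m = tree_size (set_tree S)"
    and "s = tree_size (set_tree ?S)"
  note sizes = this
  have "s \<le> m + b"
    unfolding sizes using tree_size_set_tree_append[of B S] by auto
  then have "60 * g * (s + g) \<le> 60 * g * (m + (2 + a + b + g))"
    by (intro mult_left_mono) auto
  moreover have "20 + 40 * a * m + 10 * b \<le> 60 * (2 + a + b) * (m + (2 + a + b + g))"
    by (simp add: algebra_simps)
  ultimately have time: "20 + 40 * a * m + 10 * b + 60 * g * (s + g)
      \<le> 60 * (2 + a + b + g) * (m + (2 + a + b + g))"
    by (simp add: algebra_simps)
  \<comment> \<open>The conditional stands outside \<open>set_tree\<close>, as
    \<open>computes_If_bool\<close> delivers it.\<close>
  have IH: "calls 5 [base_tree \<Gamma>, if set A \<subseteq> set S then set_tree (B @ S) else set_tree S]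
      (set_tree (forward \<Gamma> ?S)) (60 * g * (s + g))"
    using 2 unfolding sizes by (simp split: if_splits)
  have size: "tree_size (Node (Node (set_tree A) (set_tree B)) (base_tree \<Gamma>)) = 2 + a + b + g"
    by (simp add: sizes)
  show ?case
    unfolding mcc_program_nth(6) forward_body_def unfold_trees size
      sizes(1)[symmetric] sizes(2)[symmetric] sizes(4)[symmetric]
    by (rule computes_weaken, (rule computes_rules computes_subset computes_append IH)+, simp)
      (use time in \<open>simp add: sizes(1,2,4)[symmetric]\<close>)
qed

lemma tree_size_saturate:
  "tree_size (set_tree (saturate xs \<Gamma> S)) \<le> tree_size (set_tree S) + length xs * tree_size (base_tree \<Gamma>)"
proof (induction xs arbitrary: S)
  case (Cons x xs)
  show ?case using Cons.IH[of "forward \<Gamma> S"] tree_size_forward[of \<Gamma> S] by simp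
qed simp

lemma computes_saturate:
  "calls 6 [set_tree xs, base_tree \<Gamma>, set_tree S] (set_tree (saturate xs \<Gamma> S))
    (70 * (length xs + 1) * tree_size (base_tree \<Gamma>) *
      (tree_size (set_tree S) + (length xs + 1) * tree_size (base_tree \<Gamma>)))"
proof (induction xs arbitrary: S)
  case Nil
  have "3 * 1 \<le> 70 * tree_size (base_tree \<Gamma>) * (tree_size (set_tree S) + tree_size (base_tree \<Gamma>))"
    by (intro mult_le_mono trans_le_add1 tree_size_ge_1) (use tree_size_ge_1[of "base_tree \<Gamma>"] in linarith)
  then show ?case
    unfolding mcc_program_nth saturate_body_def unfold_trees
    by (intro computes_weaken[OF computes_If_Leaf[OF computes_Var(1) computes_Var(3)]]) simp_all
next
  case (Cons x xs)
  define g m s p where "g = tree_size (base_tree \<Gamma>)" and "m = tree_size (set_tree S)"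
    and "s = tree_size (set_tree (forward \<Gamma> S))" and "p = length xs + 1"
  note sizes = this
  have "s \<le> m + g" unfolding sizes by (rule tree_size_forward)
  then have "70 * p * g * (s + p * g) \<le> 70 * p * g * (m + (p + 1) * g)"
    by (intro mult_left_mono) auto
  moreover have "10 + 60 * g * (m + g) \<le> 70 * g * (m + (p + 1) * g)"
  proof -
    have "1 \<le> g" "1 \<le> m" unfolding sizes by (rule tree_size_ge_1)+
  then have "10 * 1 \<le> 10 * g * m" by (intro mult_le_mono) auto
  then have "10 + 60 * g * (m + g) \<le> 10 * g * m + 60 * g * (m + g)" by linarith
  also have "\<dots> \<le> 70 * g * (m + (p + 1) * g)" by (simp add: algebra_simps)
  finally show ?thesis .
  qed
  ultimately have time: "10 + 60 * g * (m + g) + 70 * p * g * (s + p * g)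
      \<le> 70 * (p + 1) * g * (m + (p + 1) * g)"
    by (simp add: algebra_simps)
  show ?case
    unfolding mcc_program_nth(7) saturate_body_def unfold_trees
    by (rule computes_weaken, (rule computes_rules computes_forward Cons.IH)+, simp)
      (use time in \<open>simp add: sizes\<close>)
qed

lemma computes_some_subset:
  "calls 7 [family_tree Es, set_tree S] (bool_tree (\<exists>e\<in>set Es. set e \<subseteq> set S))
    (60 * tree_size (family_tree Es) * tree_size (set_tree S))"
proof (induction Es)
  case Nil
  show ?case
    unfolding mcc_program_nth some_subset_body_def unfold_trees
    by (rule computes_weaken, (rule computes_rules computes_false)+)
      (use tree_size_ge_1[of "set_tree S"] in simp_all)
next
  case (Cons e Es)
  show ?case
    unfolding mcc_program_nth(8) some_subset_body_def unfold_trees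
    by (rule computes_weaken, (rule computes_rules computes_true computes_subset Cons.IH)+, simp)
      (use tree_size_ge_1[of "set_tree S"] in \<open>simp add: algebra_simps\<close>)
qed

lemma computes_some_superset:
  "calls 8 [set_tree S, family_tree Ts] (bool_tree (\<exists>T\<in>set Ts. set S \<subseteq> set T))
    (60 * tree_size (set_tree S) * tree_size (family_tree Ts))"
proof (induction Ts)
  case Nil
  show ?case
    unfolding mcc_program_nth some_superset_body_def unfold_trees
    by (rule computes_weaken, (rule computes_rules computes_false)+)
      (use tree_size_ge_1[of "set_tree S"] in simp_all)
next
  case (Cons T Ts)
  show ?case
    unfolding mcc_program_nth(9) some_superset_body_def unfold_trees
    by (rule computes_weaken, (rule computes_rules computes_true computes_subset Cons.IH)+, simp)
      (use tree_size_ge_1[of "set_tree S"] in \<open>simp add: algebra_simps\<close>)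
qed

text \<open>Of several lists with the same elements at most the last survives, so duplicates
  disappear as well.\<close>

fun maximize :: "'a list list \<Rightarrow> 'a list list \<Rightarrow> 'a list list" where
  "maximize acc [] = acc"
| "maximize acc (S # Ss) =
    (if (\<exists>T\<in>set Ss. set S \<subseteq> set T) \<or> (\<exists>T\<in>set acc. set S \<subseteq> set T)
     then maximize acc Ss else maximize (S # acc) Ss)"

text \<open>The combined size of both lists never grows, since a set is either dropped or moved from
  one to the other. The two superset tests per set cost at most \<open>60 * b ^ 2\<close>
  each.\<close>

lemma computes_maximize:
  assumes "tree_size (family_tree acc) + tree_size (family_tree Ss) \<le> b"
  shows "calls 9 [family_tree acc, family_tree Ss] (family_tree (maximize acc Ss))
    (150 * b\<^sup>2 * (length Ss + 1))"
  using assms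
proof (induction Ss arbitrary: acc)
  case Nil
  then have "1 \<le> b\<^sup>2" using tree_size_ge_1[of "family_tree acc"] by simp
  then show ?case
    unfolding mcc_program_nth maximize_body_def unfold_trees
    by (intro computes_weaken[OF computes_If_Leaf[OF computes_Var(2) computes_Var(1)]]) simp_all
next
  case (Cons S Ss)
  define s a t where "s = tree_size (set_tree S)" and "a = tree_size (family_tree acc)"
    and "t = tree_size (family_tree Ss)"
  note sizes = this
  have b: "a + (1 + s + t) \<le> b" using Cons.prems by (simp add: sizes)
  have "s * t \<le> b\<^sup>2" "s * a \<le> b\<^sup>2" "1 * 1 \<le> b\<^sup>2"
    unfolding power2_eq_square using b by (intro mult_mono; simp)+
  then have "30 + 60 * (s * t) + 60 * (s * a) \<le> 150 * b\<^sup>2" by linarith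
  then have time: "30 + 60 * s * t + 60 * s * a + 150 * b\<^sup>2 * (length Ss + 1) \<le> 150 * b\<^sup>2 * (length (S # Ss) + 1)"
    by (simp add: algebra_simps)
  have IH: "calls 9 [family_tree acc, family_tree Ss] (family_tree (maximize acc Ss)) (150 * b\<^sup>2 * (length Ss + 1))"
    "calls 9 [Node (set_tree S) (family_tree acc), family_tree Ss]
      (family_tree (maximize (S # acc) Ss)) (150 * b\<^sup>2 * (length Ss + 1))"
    using Cons.IH[of acc] Cons.IH[of "S # acc"] b by (simp_all add: sizes)
  show ?case
    unfolding mcc_program_nth(10) maximize_body_def unfold_trees
    by (rule computes_weaken, (rule computes_rules computes_some_superset IH)+, simp)
      (use time in \<open>simp add: sizes\<close>)
qed

text \<open>Prefixing \<open>v\<close> shares the old lists, so the time depends on their number and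
  not on their sizes.\<close>

lemma computes_insert_all:
  "calls 10 [tree_of_nat v, family_tree Ss, family_tree acc] (family_tree (map ((#) v) Ss @ acc))
    (15 * (length Ss + 1))"
proof (induction Ss)
  case Nil
  show ?case
    unfolding mcc_program_nth insert_all_body_def unfold_trees
    by (rule computes_weaken, (rule computes_rules)+) simp_all
next
  case (Cons S Ss)
  show ?case
    unfolding mcc_program_nth(11) insert_all_body_def unfold_trees
    by (rule computes_weaken, (rule computes_rules Cons.IH)+) simp_all
qed

section \<open>Correctness of the closure computation\<close>

abbreviation base_of :: "('a list \<times> 'a list) list \<Rightarrow> 'a implication set" where
  "base_of \<Gamma> \<equiv> (\<lambda>(A, B). (set A, set B)) ` set \<Gamma>"

lemma forward_extends: "set S \<subseteq> set (forward \<Gamma> S)"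
  by (induction \<Gamma> S rule: forward.induct) (auto split: if_splits)

lemma forward_fires: "(A, B) \<in> set \<Gamma> \<Longrightarrow> set A \<subseteq> set S \<Longrightarrow> set B \<subseteq> set (forward \<Gamma> S)"
proof (induction \<Gamma> S rule: forward.induct)
  case (2 A' B' \<Gamma> S)
  show ?case
  proof (cases "(A, B) = (A', B')")
    case True
    then show ?thesis using 2(3) forward_extends[of "B @ S" \<Gamma>] by auto
  next
    case False
    then have "(A, B) \<in> set \<Gamma>" "set A \<subseteq> set (if set A' \<subseteq> set S then B' @ S else S)" using 2(2,3) by auto
    from 2(1)[OF this] show ?thesis by simp
  qed
qed simp

lemma forward_within: "satisfies F (base_of \<Gamma>) \<Longrightarrow> set S \<subseteq> F \<Longrightarrow> set (forward \<Gamma> S) \<subseteq> F"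
proof (induction \<Gamma> S rule: forward.induct)
  case (2 A B \<Gamma> S)
  then have "satisfies F (base_of \<Gamma>)" "set (if set A \<subseteq> set S then B @ S else S) \<subseteq> F"
    unfolding satisfies_def by auto
  from 2(1)[OF this] show ?case by simp
qed simp

lemma saturate_extends: "set S \<subseteq> set (saturate xs \<Gamma> S)"
proof (induction xs arbitrary: S)
  case (Cons x xs)
  show ?case using Cons.IH[of "forward \<Gamma> S"] forward_extends[of S \<Gamma>] by simp
qed simp

lemma saturate_within: "satisfies F (base_of \<Gamma>) \<Longrightarrow> set S \<subseteq> F \<Longrightarrow> set (saturate xs \<Gamma> S) \<subseteq> F"
  by (induction xs arbitrary: S) (simp_all add: forward_within)

text \<open>A pass that adds no element has fired every applicable implication, so the set is closed
  and later passes leave it unchanged; every other pass adds a new element.\<close>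

lemma saturate_progress:
  "satisfies (set (saturate xs \<Gamma> S)) (base_of \<Gamma>) \<or> length xs \<le> card (set (saturate xs \<Gamma> S) - set S)"
proof (induction xs arbitrary: S)
  case (Cons x xs)
  let ?S = "forward \<Gamma> S"
  show ?case
  proof (cases "set ?S = set S")
    case True
    have sat: "satisfies (set ?S) (base_of \<Gamma>)"
      unfolding satisfies_def True using forward_fires[of _ _ \<Gamma> S] True by auto
    have "set (saturate xs \<Gamma> ?S) = set ?S"
      using saturate_within[OF sat subset_refl] saturate_extends by (rule subset_antisym)
    then show ?thesis using sat by simp
  next
    case False
    then obtain y where y: "y \<in> set ?S" "y \<notin> set S" using forward_extends[of S \<Gamma>] by blast
    have "set (saturate xs \<Gamma> ?S) - set ?S \<subset> set (saturate xs \<Gamma> ?S) - set S"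
      using y saturate_extends[of ?S xs \<Gamma>] forward_extends[of S \<Gamma>] by blast
    then have "card (set (saturate xs \<Gamma> ?S) - set ?S) < card (set (saturate xs \<Gamma> ?S) - set S)"
      by (intro psubset_card_mono) simp_all
    then show ?thesis using Cons.IH[of ?S] by auto
  qed
qed simp

lemma set_saturate:
  assumes "distinct xs" "implicational_base (set xs) (base_of \<Gamma>)" "set S \<subseteq> set xs"
  shows "set (saturate xs \<Gamma> S) = cl (set xs) (base_of \<Gamma>) (set S)"
proof (rule subset_antisym)
  show "set (saturate xs \<Gamma> S) \<subseteq> cl (set xs) (base_of \<Gamma>) (set S)"
    using cl_closed[OF assms(2,3)] unfolding closed_sets_def
    by (intro saturate_within cl_extensive) simp
  have X: "satisfies (set xs) (base_of \<Gamma>)"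
    using assms(2) unfolding satisfies_def implicational_base_def by auto
  have within: "set (saturate xs \<Gamma> S) \<subseteq> set xs" by (rule saturate_within[OF X assms(3)])
  have "satisfies (set (saturate xs \<Gamma> S)) (base_of \<Gamma>)"
  proof (rule disjE[OF saturate_progress[of xs \<Gamma> S]])
    \<comment> \<open>With as many passes as elements, a gain in each pass exhausts the ground set,
      which satisfies the base.\<close>
    assume "length xs \<le> card (set (saturate xs \<Gamma> S) - set S)"
    also have "\<dots> \<le> card (set (saturate xs \<Gamma> S))" by (intro card_mono) auto
    finally have "set (saturate xs \<Gamma> S) = set xs"
      using within distinct_card[OF assms(1)] by (intro card_seteq) auto
    then show ?thesis using X by simp
  qed
  then show "cl (set xs) (base_of \<Gamma>) (set S) \<subseteq> set (saturate xs \<Gamma> S)"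
    using within by (intro cl_least saturate_extends) (simp add: closed_sets_def)
qed

section \<open>Enumerating the facets\<close>

text \<open>Distinctness of \<open>map set Ss\<close> excludes two orderings of one set; with
  repetition-free entries this is what \<open>enc_set\<close> demands of an output.\<close>

definition lists_family :: "'a list list \<Rightarrow> 'a set set \<Rightarrow> bool" where
  "lists_family Ss \<F> \<longleftrightarrow>
    distinct (map set Ss) \<and> set ` set Ss = \<F> \<and> (\<forall>S\<in>set Ss. distinct S)"

lemma length_lists_family: "lists_family Ss \<F> \<Longrightarrow> length Ss = card \<F>"
  unfolding lists_family_def using distinct_card[of "map set Ss"] by simp

lemma maximal_members_insert_redundant:
  assumes "B \<in> \<S>" "A \<subseteq> B"
  shows "maximal_members (insert A \<S>) = maximal_members \<S>"
  by (rule maximal_members_cofinal) (use assms in auto)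

text \<open>Invariant: \<open>acc\<close> is an antichain and no accepted set lies below a pending
  one, as was checked on acceptance. Once nothing is pending, all accepted sets are maximal.\<close>

lemma lists_family_maximize:
  assumes "distinct (map set acc)" "\<And>S. S \<in> set acc \<Longrightarrow> distinct S" "\<And>S. S \<in> set Ss \<Longrightarrow> distinct S"
    and "\<And>S T. S \<in> set acc \<Longrightarrow> T \<in> set acc \<Longrightarrow> set S \<subseteq> set T \<Longrightarrow> set T = set S"
    and "\<And>S T. S \<in> set acc \<Longrightarrow> T \<in> set Ss \<Longrightarrow> \<not> set S \<subseteq> set T"
  shows "lists_family (maximize acc Ss) (maximal_members (set ` (set acc \<union> set Ss)))"
  using assms
proof (induction Ss arbitrary: acc)
  case Nil
  have "set ` set acc \<subseteq> maximal_members (set ` set acc)"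
  proof
    fix A assume "A \<in> set ` set acc"
    then show "A \<in> maximal_members (set ` set acc)"
      using Nil(4) by (intro maximal_membersI) (simp, elim imageE, simp)
  qed
  moreover have "maximal_members (set ` set acc) \<subseteq> set ` set acc"
    using maximal_membersD(1) by (rule subsetI)
  ultimately have "maximal_members (set ` set acc) = set ` set acc" by (intro subset_antisym)
  then show ?case using Nil(1,2) by (simp add: lists_family_def)
next
  case (Cons S Ss)
  have distinct_tail: "\<And>T. T \<in> set Ss \<Longrightarrow> distinct T" using Cons.prems(3) by simp
  show ?case
  proof (cases "\<exists>T\<in>set acc \<union> set Ss. set S \<subseteq> set T")
    case True
    have "lists_family (maximize acc Ss) (maximal_members (set ` (set acc \<union> set Ss)))"
      using Cons.prems(5) by (intro Cons.IH[OF Cons.prems(1,2) distinct_tail Cons.prems(4)]) simp_all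
    moreover have "maximal_members (insert (set S) (set ` (set acc \<union> set Ss))) = maximal_members (set ` (set acc \<union> set Ss))"
      using True by (elim bexE) (rule maximal_members_insert_redundant[OF imageI])
    moreover have "maximize acc (S # Ss) = maximize acc Ss" using True by auto
    ultimately show ?thesis by simp
  next
    case False
    have "lists_family (maximize (S # acc) Ss) (maximal_members (set ` (set (S # acc) \<union> set Ss)))"
    proof (rule Cons.IH)
      show "distinct (map set (S # acc))" using Cons.prems(1) False by auto
    next
      fix T assume "T \<in> set (S # acc)"
      then show "distinct T" using Cons.prems(2,3) by auto
    next
      fix T U assume T: "T \<in> set (S # acc)" and U: "U \<in> set (S # acc)" and TU: "set T \<subseteq> set U"
      then consider "T = S" "U = S" | "T = S" "U \<in> set acc" | "T \<in> set acc" "U = S"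
        | "T \<in> set acc" "U \<in> set acc" by auto
      then show "set U = set T"
      proof cases
        case 2
        then show ?thesis using TU False by simp
      next
        case 3
        then show ?thesis using TU Cons.prems(5)[of T S] by simp
      next
        case 4
        then show ?thesis using TU Cons.prems(4)[of T U] by simp
      qed simp
    next
      fix T U assume "T \<in> set (S # acc)" "U \<in> set Ss"
      then show "\<not> set T \<subseteq> set U" using Cons.prems(5)[of T U] False by auto
    qed (rule distinct_tail)
    moreover have "maximize acc (S # Ss) = maximize (S # acc) Ss" using False by auto
    ultimately show ?thesis by simp
  qed
qed

section \<open>Sizes of encoded sets and families\<close>

lemma tree_size_set_tree: "tree_size (set_tree xs) = 1 + (\<Sum>x\<leftarrow>xs. 1 + tree_size (tree_of_nat x))"
  by (induction xs) simp_all

lemma tree_size_set_tree_mono: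
  assumes "distinct ys" "distinct xs" "set ys \<subseteq> set xs"
  shows "tree_size (set_tree ys) \<le> tree_size (set_tree xs)"
  unfolding tree_size_set_tree sum_list_distinct_conv_sum_set[OF assms(1)]
    sum_list_distinct_conv_sum_set[OF assms(2)]
  by (intro add_left_mono sum_mono2 assms(3)) simp_all

lemma length_less_tree_size: "length xs < tree_size (set_tree xs)"
  by (induction xs) simp_all

lemma tree_size_family_tree:
  assumes "\<And>S. S \<in> set Ss \<Longrightarrow> tree_size (set_tree S) \<le> s"
  shows "tree_size (family_tree Ss) \<le> 1 + length Ss * (1 + s)"
  using assms by (induction Ss) fastforce+


text \<open>\<open>time_unit z n\<close> bounds the work of one call of the recursive enumeration, its recursive
  calls excluded, on an instance of size \<open>z\<close> with \<open>n\<close> solutions. A call whose second argument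
  has \<open>d + 1 - q\<close> elements and whose first argument has \<open>m\<close> elements starts at most
  \<open>call_bound n q m\<close> calls.\<close>

definition time_unit :: "nat \<Rightarrow> nat \<Rightarrow> nat" where
  "time_unit z n = 300 * z ^ 4 + 25 + n * (15 * n + 45) + 150 * (2 + n * (n + 1) * (1 + z)) ^ 3"

definition call_bound :: "nat \<Rightarrow> nat \<Rightarrow> nat \<Rightarrow> nat" where
  "call_bound n q m = ((n + 1) * (m + 1)) ^ q"

lemma call_bound_ge_1: "1 \<le> call_bound n q m"
  unfolding call_bound_def by (intro one_le_power) simp

lemma call_bound_mono: "m \<le> m' \<Longrightarrow> call_bound n q m \<le> call_bound n q m'"
  unfolding call_bound_def by (intro power_mono mult_mono) auto

text \<open>The terms on the left count the call itself, the calls for the smaller \<open>V\<close>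
  with the same \<open>L\<close>, and those for at most \<open>n\<close> facets with one more
  element in \<open>L\<close>. The first and third together are at most
  \<open>(n + 1) * call_bound n q m\<close>, which turns the factor \<open>m + 1\<close> of the
  second into \<open>m + 2\<close>.\<close>

lemma call_bound_rec:
  "1 + call_bound n (Suc q) m + n * call_bound n q m \<le> call_bound n (Suc q) (Suc m)"
proof -
  have "1 + n * call_bound n q m \<le> (n + 1) * call_bound n q m"
    using call_bound_ge_1[of n q m] by simp
  then have "1 + call_bound n (Suc q) m + n * call_bound n q m
      \<le> (n + 1) * (m + 2) * call_bound n q m"
    unfolding call_bound_def by (simp add: algebra_simps)
  also have "\<dots> \<le> (n + 1) * (m + 2) * call_bound n q (Suc m)"
    using call_bound_mono[of m "Suc m"] by (intro mult_left_mono) auto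
  finally show ?thesis unfolding call_bound_def by (simp add: algebra_simps)
qed

section \<open>The recursive enumeration on a fixed encoded instance\<close>

locale mcc_instance =
  fixes xs :: "nat list" and \<Gamma> :: "(nat list \<times> nat list) list" and Es :: "nat list list" and d :: nat
  assumes distinct: "distinct xs"
    and base: "implicational_base (set xs) (base_of \<Gamma>)"
    and dim: "\<And>F. F \<subseteq> set xs \<Longrightarrow>
      consistent.minimal_nonmember (set xs) (base_of \<Gamma>) (set ` set Es) F \<Longrightarrow> card F \<le> d"
begin

abbreviation "con \<equiv> consistent (set xs) (base_of \<Gamma>) (set ` set Es)"
abbreviation "facets \<equiv> consistent.facets (set xs) (base_of \<Gamma>) (set ` set Es)"

definition input where "input = Node (set_tree xs) (Node (base_tree \<Gamma>) (family_tree Es))"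
definition "z = tree_size input"
definition "n = card (facets (set xs) {})"

lemma size_bounds:
  "tree_size (set_tree xs) \<le> z" "length xs + 1 \<le> z" "tree_size (base_tree \<Gamma>) \<le> z"
  "tree_size (family_tree Es) \<le> z" "1 \<le> z"
  unfolding z_def input_def using length_less_tree_size[of xs] by auto

lemma length_facets:
  assumes "lists_family Ss (facets V L)" "V \<subseteq> set xs" "L \<subseteq> set xs"
  shows "length Ss \<le> n"
  unfolding length_lists_family[OF assms(1)] n_def
  by (rule consistent.card_facets_le) (use assms in auto)

text \<open>Saturation with the ground set as counter costs at most \<open>140 * z ^ 4\<close> and
  the search for an edge in the result at most \<open>120 * z ^ 4\<close>; the rest covers appending
  and constants.\<close>

lemma computes_inconsistent:
  assumes VL: "distinct (V @ L)" "set V \<union> set L \<subseteq> set xs"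
  shows "computes mcc_program [input, set_tree V, set_tree L]
    (Call 7 [Right (Right (Var 0)), Call 6 [Left (Var 0), Left (Right (Var 0)), Call 4 [Var 1, Var 2]]])
    (bool_tree (\<not> con (set V \<union> set L))) (300 * z ^ 4)"
proof -
  let ?T = "set_tree (saturate xs \<Gamma> (V @ L))"
  have size: "tree_size (set_tree (V @ L)) \<le> z"
    using tree_size_set_tree_mono[OF VL(1) distinct] VL(2) size_bounds(1) by auto
  have sizeV: "tree_size (set_tree V) \<le> z"
    using tree_size_set_tree_mono[of V xs] VL distinct size_bounds(1) by auto
  have z2: "(length xs + 1) * tree_size (base_tree \<Gamma>) \<le> z * z"
    by (intro mult_mono size_bounds) auto
  have zz: "z \<le> z * z" using size_bounds(5) by simp
  have "z * z * (z * z) = z ^ 4" by (simp add: power4_eq_xxxx algebra_simps)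
  then have sat: "70 * (length xs + 1) * tree_size (base_tree \<Gamma>) *
      (tree_size (set_tree (V @ L)) + (length xs + 1) * tree_size (base_tree \<Gamma>)) \<le> 140 * z ^ 4"
    using mult_mono[OF z2 add_mono[OF order_trans[OF size zz] z2]]
    by (simp add: algebra_simps)
  have T: "tree_size ?T \<le> z + z * z"
    using tree_size_saturate[of xs \<Gamma> "V @ L"] size z2 by simp
  have "tree_size (family_tree Es) * tree_size ?T \<le> z * z * (z + z * z)"
    by (intro mult_mono T order_trans[OF size_bounds(4) zz]) auto
  also have "\<dots> \<le> z * z * (2 * (z * z))" using zz by (intro mult_left_mono) auto
  finally have some: "60 * tree_size (family_tree Es) * tree_size ?T \<le> 120 * z ^ 4"
    by (simp add: power4_eq_xxxx algebra_simps)
  have z4: "z \<le> z ^ 4" "1 \<le> z ^ 4" using size_bounds(5) by (auto simp: self_le_power)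
  have "set (saturate xs \<Gamma> (V @ L)) = cl (set xs) (base_of \<Gamma>) (set V \<union> set L)"
    using set_saturate[OF distinct base, of "V @ L"] VL(2) by simp
  then have test: "(\<exists>e\<in>set Es. set e \<subseteq> set (saturate xs \<Gamma> (V @ L))) = (\<not> con (set V \<union> set L))"
    unfolding consistent_def graph_independent_def by auto
  show ?thesis
    unfolding input_def
    by (rule computes_weaken, (rule computes_rules computes_some_subset computes_saturate computes_append)+)
      (simp only: test, use sat some z4 sizeV in linarith)
qed

text \<open>\<open>G\<close>, \<open>T\<close> and \<open>k\<close> abstract the results, the time
  and the output length of the recursive calls, so that the loop over \<open>R\<close> is analysed
  apart from the recursion on \<open>V\<close>.\<close>

lemma computes_candidates:
  assumes "\<And>M. M \<in> set R \<Longrightarrow> \<exists>Ss. calls 11 [input, set_tree M, set_tree (v # L)] (family_tree Ss) T \<and>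
      lists_family Ss (G (set M)) \<and> length Ss \<le> k"
    and "\<And>M. M \<in> set R \<Longrightarrow> distinct M \<and> set M \<subseteq> V \<and> (\<forall>S\<in>G (set M). S \<subseteq> V)" "v \<notin> V"
  shows "\<exists>Cs. calls 12 [input, tree_of_nat v, set_tree L, family_tree R] (family_tree Cs)
        (length R * (T + 15 * k + 45) + 5) \<and>
      set ` set Cs = (\<Union>M\<in>set ` set R. insert M (insert v ` G M)) \<and>
      length Cs \<le> length R * (k + 1) \<and>
      (\<forall>S\<in>set Cs. distinct S \<and> set S \<subseteq> insert v V)"
  using assms
proof (induction R)
  case Nil
  have "calls 12 [input, tree_of_nat v, set_tree L, family_tree []] (family_tree []) 5"
    unfolding mcc_program_nth candidates_body_def unfold_trees
    by (intro computes_weaken[OF computes_If_Leaf[OF computes_Var(4) computes_Nil]]) simp_all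
  then show ?case by (intro exI[of _ "[]"]) simp
next
  case (Cons M R)
  obtain Ss where Ss: "calls 11 [input, set_tree M, set_tree (v # L)] (family_tree Ss) T"
    "lists_family Ss (G (set M))" "length Ss \<le> k" using Cons.prems(1)[of M] by auto
  obtain Cs where Cs: "calls 12 [input, tree_of_nat v, set_tree L, family_tree R] (family_tree Cs)
        (length R * (T + 15 * k + 45) + 5)"
    "set ` set Cs = (\<Union>M\<in>set ` set R. insert M (insert v ` G M))"
    "length Cs \<le> length R * (k + 1)" "\<forall>S\<in>set Cs. distinct S \<and> set S \<subseteq> insert v V"
    using Cons.IH[OF Cons.prems(1,2,3)] by auto
  let ?Cs = "M # map ((#) v) Ss @ Cs"
  have calls: "calls 12 [input, tree_of_nat v, set_tree L, family_tree (M # R)] (family_tree ?Cs)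
        (length (M # R) * (T + 15 * k + 45) + 5)"
    unfolding mcc_program_nth(13) candidates_body_def unfold_trees
    by (rule computes_weaken, (rule computes_rules computes_insert_all Ss(1)[unfolded unfold_trees] Cs(1))+, simp)
      (use Ss(3) in simp)
  have G: "set ` set Ss = G (set M)" "\<And>S. S \<in> set Ss \<Longrightarrow> distinct S"
    using Ss(2) unfolding lists_family_def by auto
  have "set ` set (map ((#) v) Ss) = insert v ` (set ` set Ss)" by (auto simp: image_image)
  then have union: "set ` set ?Cs = (\<Union>M\<in>set ` set (M # R). insert M (insert v ` G M))"
    using Cs(2) G(1) by (simp add: image_Un)
  have "set S \<subseteq> V" "v \<notin> set S" if "S \<in> set Ss" for S
    using Cons.prems(2)[of M] imageI[OF that, of set] \<open>v \<notin> V\<close> unfolding G(1) by auto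
  then have "\<forall>S\<in>set (map ((#) v) Ss). distinct S \<and> set S \<subseteq> insert v V"
    using G(2) by (simp add: subset_insertI2)
  then have "\<forall>S\<in>set ?Cs. distinct S \<and> set S \<subseteq> insert v V"
    using Cs(4) Cons.prems(2)[of M] by (simp add: ball_Un subset_insertI2)
  moreover have "length ?Cs \<le> length (M # R) * (k + 1)" using Cs(3) Ss(3) by simp
  ultimately show ?case using calls union by blast
qed

text \<open>By the last hypothesis, an inconsistent call has \<open>length L \<le> d\<close>, so
  adding \<open>v\<close> leads to length at most \<open>d + 1\<close>. At length
  \<open>d + 1\<close> a call is consistent and returns at once, in accordance with the exponent 0
  in \<open>call_bound\<close>.\<close>

lemma computes_facets:
  assumes "distinct (V @ L)" "set V \<union> set L \<subseteq> set xs" "length L \<le> d + 1"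
    and "\<And>F. consistent.minimal_nonmember (set xs) (base_of \<Gamma>) (set ` set Es) F \<Longrightarrow>
      F \<subseteq> set V \<union> set L \<Longrightarrow> set L \<subseteq> F"
  shows "\<exists>Ss. calls 11 [input, set_tree V, set_tree L] (family_tree Ss)
      (time_unit z n * call_bound n (d + 1 - length L) (length V)) \<and>
    lists_family Ss (facets (set V) (set L))"
  using assms
proof (induction "length V" arbitrary: V L rule: less_induct)
  case less
  note test = computes_inconsistent[OF less.prems(1,2)]
  \<comment> \<open>Covers calls without recursion: one consistency test and the construction of the
    answer.\<close>
  have unit: "300 * z ^ 4 + 5 \<le> time_unit z n * call_bound n q m" for q m
  proof -
    have "300 * z ^ 4 + 5 \<le> time_unit z n * 1" unfolding time_unit_def by simp
    also have "\<dots> \<le> time_unit z n * call_bound n q m" by (rule mult_le_mono2[OF call_bound_ge_1])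
    finally show ?thesis .
  qed
  show ?case
  proof (cases "con (set V \<union> set L)")
    case True
    have branch: "computes mcc_program [input, set_tree V, set_tree L]
        (Cons_exp (Var 1) Nil_exp) (family_tree [V]) 3"
      by (rule computes_weaken[OF computes_Cons[OF computes_Var(2) computes_Nil]]) simp_all
    have "calls 11 [input, set_tree V, set_tree L] (family_tree [V])
      (time_unit z n * call_bound n (d + 1 - length L) (length V))"
      unfolding mcc_program_nth facets_body_def
      \<comment> \<open>\<open>Leaf\<close> and time 0 are placeholders for the branch not
        taken.\<close>
      by (rule computes_weaken[OF computes_If_bool[where ?v1.0 = Leaf and ?t1.0 = 0, OF test _ branch]])
        (use True unit[of "d + 1 - length L" "length V"] in simp_all)
    moreover have "lists_family [V] (facets (set V) (set L))"
      unfolding consistent.facets_consistent[OF True] using less.prems(1) by (simp add: lists_family_def)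
    ultimately show ?thesis by blast
  next
    case inconsistent: False
    show ?thesis
    proof (cases V)
      case Nil
      have "calls 11 [input, set_tree V, set_tree L] (family_tree [])
        (time_unit z n * call_bound n (d + 1 - length L) (length V))"
        unfolding mcc_program_nth facets_body_def unfolding Nil unfold_trees
        by (rule computes_weaken, (rule test[unfolded Nil unfold_trees] computes_rules computes_Nil)+)
          (use inconsistent unit[of "d + 1 - length L" "length V"] in \<open>simp_all add: Nil\<close>)
      moreover have "lists_family [] (facets (set V) (set L))"
        using consistent.facets_empty_inconsistent[of _ _ _ "set L"] inconsistent
        unfolding Nil by (simp add: lists_family_def)
      ultimately show ?thesis by blast
    next
      case V: (Cons v V')
      define q where "q = d - length L"
      \<comment> \<open>Some minimal inconsistent set lies in \<open>set V \<union> set L\<close>;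
        it contains \<open>set L\<close> and has at most \<open>d\<close> elements.\<close>
      have "length L \<le> d"
      proof -
        obtain F where F: "F \<subseteq> set V \<union> set L"
          "consistent.minimal_nonmember (set xs) (base_of \<Gamma>) (set ` set Es) F"
          using consistent.minimal_nonmember_below[OF _ inconsistent] by auto
        have "length L = card (set L)" using less.prems(1) distinct_card[of L] by simp
        also have "\<dots> \<le> card F"
          using less.prems(4)[OF F(2,1)] F(1) by (intro card_mono) (auto intro: finite_subset)
        also have "\<dots> \<le> d" using F less.prems(2) by (intro dim) auto
        finally show ?thesis .
      qed
      \<comment> \<open>The recursive call on \<open>V'\<close> keeps the exponent
        \<open>Suc q\<close>; those that add \<open>v\<close> to \<open>L\<close> lower it to
        \<open>q\<close>.\<close>
      then have q: "d + 1 - length L = Suc q" "d + 1 - length (v # L) = q" unfolding q_def by auto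
      have prems': "distinct (V' @ L)" "set V' \<union> set L \<subseteq> set xs"
        "\<And>F. consistent.minimal_nonmember (set xs) (base_of \<Gamma>) (set ` set Es) F \<Longrightarrow>
          F \<subseteq> set V' \<union> set L \<Longrightarrow> set L \<subseteq> F"
        using less.prems(1,2) less.prems(4)[OF _ order_trans] by (simp_all add: V subset_insertI)
      obtain R where R: "calls 11 [input, set_tree V', set_tree L] (family_tree R)
          (time_unit z n * call_bound n (Suc q) (length V'))"
        "lists_family R (facets (set V') (set L))"
        using less.hyps[of V' L] prems' less.prems(3) unfolding q(1) by (auto simp: V)
      have members: "distinct M" "set M \<subseteq> set V'" "set M \<in> facets (set V') (set L)" if "M \<in> set R" for M
      proof -
        have "set ` set R = facets (set V') (set L)" using R(2) by (simp add: lists_family_def)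
        then show facet: "set M \<in> facets (set V') (set L)" using imageI[OF that, of set] by simp
        show "distinct M" using R(2) that by (simp add: lists_family_def)
        show "set M \<subseteq> set V'" using consistent.facetsD(1)[OF facet] .
      qed
      define T where "T = time_unit z n * call_bound n q (length V')"
      have rec: "\<exists>Ss. calls 11 [input, set_tree M, set_tree (v # L)] (family_tree Ss) T \<and>
          lists_family Ss (facets (set M) (insert v (set L))) \<and> length Ss \<le> n" if M: "M \<in> set R" for M
      proof -
        note M = members[OF M]
        have "length M \<le> length V'"
          using M(1,2) less.prems(1) card_mono[OF _ M(2)] by (simp add: V distinct_card)
        have "\<exists>Ss. calls 11 [input, set_tree M, set_tree (v # L)] (family_tree Ss)
            (time_unit z n * call_bound n (d + 1 - length (v # L)) (length M)) \<and>
          lists_family Ss (facets (set M) (set (v # L)))"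
        proof (rule less.hyps)
          show "length M < length V" using \<open>length M \<le> length V'\<close> V by simp
          show "distinct (M @ v # L)" "set M \<union> set (v # L) \<subseteq> set xs"
            using M(1,2) less.prems(1,2) by (auto simp: V)
          show "length (v # L) \<le> d + 1" using \<open>length L \<le> d\<close> by simp
          show "set (v # L) \<subseteq> F" if "consistent.minimal_nonmember (set xs) (base_of \<Gamma>) (set ` set Es) F"
            "F \<subseteq> set M \<union> set (v # L)" for F
            using consistent.minimal_nonmembers_contain_insert[OF M(3), of v F] less.prems(4) that
            by (simp add: V)
        qed
        then obtain Ss where Ss: "calls 11 [input, set_tree M, set_tree (v # L)] (family_tree Ss)
            (time_unit z n * call_bound n q (length M))"
          "lists_family Ss (facets (set M) (insert v (set L)))" unfolding q(2) by auto
        have "time_unit z n * call_bound n q (length M) \<le> T"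
          unfolding T_def using \<open>length M \<le> length V'\<close> by (intro mult_left_mono call_bound_mono) auto
        moreover have "length Ss \<le> n"
          by (rule length_facets[OF Ss(2)]) (use M(2) less.prems(2) in \<open>auto simp: V\<close>)
        ultimately show ?thesis using computes_weaken[OF Ss(1) refl] Ss(2) by blast
      qed
      have "\<exists>Cs. calls 12 [input, tree_of_nat v, set_tree L, family_tree R] (family_tree Cs)
            (length R * (T + 15 * n + 45) + 5) \<and>
          set ` set Cs = (\<Union>M\<in>set ` set R. insert M (insert v ` facets M (insert v (set L)))) \<and>
          length Cs \<le> length R * (n + 1) \<and> (\<forall>S\<in>set Cs. distinct S \<and> set S \<subseteq> insert v (set V'))"
      proof (rule computes_candidates)
        fix M assume M: "M \<in> set R"
        show "distinct M \<and> set M \<subseteq> set V' \<and> (\<forall>S\<in>facets (set M) (insert v (set L)). S \<subseteq> set V')"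
          using members(1,2)[OF M] consistent.facetsD(1) by blast
      qed (use rec less.prems(1) V in simp_all)
      then obtain Cs where Cs: "calls 12 [input, tree_of_nat v, set_tree L, family_tree R] (family_tree Cs)
            (length R * (T + 15 * n + 45) + 5)"
          "set ` set Cs = (\<Union>M\<in>set ` set R. insert M (insert v ` facets M (insert v (set L))))"
          "length Cs \<le> length R * (n + 1)" "\<forall>S\<in>set Cs. distinct S \<and> set S \<subseteq> insert v (set V')"
        by blast
      have R_length: "length R \<le> n"
        by (rule length_facets[OF R(2)]) (use less.prems(2) V in auto)
      have Cs_length: "length Cs \<le> n * (n + 1)"
        using Cs(3) mult_le_mono1[OF R_length, of "n + 1"] by linarith
      \<comment> \<open>There are at most \<open>n * (n + 1)\<close> candidates, each of size at
        most \<open>z\<close>; the 2 counts the final leaves of their list and of the empty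
        accumulator.\<close>
      define b where "b = 2 + n * (n + 1) * (1 + z)"
      have "tree_size (set_tree S) \<le> z" if "S \<in> set Cs" for S
        using tree_size_set_tree_mono[of S xs] size_bounds(1) Cs(4) that distinct less.prems(2)
        unfolding V by fastforce
      then have "tree_size (family_tree Cs) \<le> 1 + length Cs * (1 + z)"
        by (rule tree_size_family_tree)
      then have "tree_size (family_tree []) + tree_size (family_tree Cs) \<le> b"
        using mult_le_mono1[OF Cs_length, of "1 + z"] unfolding b_def by simp
      then have maximize: "calls 9 [Leaf, family_tree Cs] (family_tree (maximize [] Cs))
          (150 * b\<^sup>2 * (length Cs + 1))"
        using computes_maximize[of "[]" Cs b] by simp
      have "length Cs + 1 \<le> b"
        using Cs_length mult_le_mono2[of 1 "1 + z" "n * (n + 1)"] unfolding b_def by linarith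
      then have "b\<^sup>2 * (length Cs + 1) \<le> b ^ 3"
        using mult_le_mono2[of "length Cs + 1" b "b\<^sup>2"] by (simp add: power2_eq_square power3_eq_cube)
      moreover have "length R * (T + 15 * n + 45) \<le> n * T + n * (15 * n + 45)"
        using mult_le_mono1[OF R_length, of "T + 15 * n + 45"] by (simp add: algebra_simps)
      \<comment> \<open>Work outside the recursive calls goes into \<open>time_unit z n\<close>; the
        calls for the facets in \<open>R\<close> leave \<open>n * T\<close>.\<close>
      ultimately have "300 * z ^ 4 + 25 + length R * (T + 15 * n + 45) + 150 * (b\<^sup>2 * (length Cs + 1))
          \<le> time_unit z n + n * T"
        unfolding time_unit_def b_def by linarith
      moreover have "time_unit z n + time_unit z n * call_bound n (Suc q) (length V') + n * T
          \<le> time_unit z n * call_bound n (Suc q) (length V)"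
        using mult_le_mono2[OF call_bound_rec[of n q "length V'"], of "time_unit z n"]
        unfolding T_def V by (simp add: algebra_simps)
      ultimately have time: "300 * z ^ 4 + 25 + time_unit z n * call_bound n (Suc q) (length V') +
          length R * (T + 15 * n + 45) + 150 * (b\<^sup>2 * (length Cs + 1))
          \<le> time_unit z n * call_bound n (Suc q) (length V)"
        by linarith
      have "calls 11 [input, set_tree V, set_tree L] (family_tree (maximize [] Cs))
        (time_unit z n * call_bound n (d + 1 - length L) (length V))"
        unfolding mcc_program_nth facets_body_def q(1) unfolding V unfold_trees
        by (rule computes_weaken,
            (rule test[unfolded V unfold_trees] computes_rules computes_Nil R(1) Cs(1) maximize)+)
          (use inconsistent time in \<open>simp_all add: V mult.assoc\<close>)
      moreover have "lists_family (maximize [] Cs) (facets (set V) (set L))"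
      proof -
        have "facets (set V) (set L) = maximal_members (set ` (set [] \<union> set Cs))"
          using consistent.facets_insert[of "set V'" v] less.prems(1) R(2) Cs(2)
          by (simp add: V lists_family_def)
        then show ?thesis using Cs(4) by (simp only:) (rule lists_family_maximize; simp)
      qed
      ultimately show ?thesis by blast
    qed
  qed
qed

text \<open>With \<open>L\<close> empty the invariant of the recursion is trivial; the extra 10 pays
  for the body of function 0.\<close>

lemma run_mcc_program:
  "\<exists>Ss t. run mcc_program input (family_tree Ss) t \<and> lists_family Ss (facets (set xs) {}) \<and>
    t \<le> time_unit z n * call_bound n (d + 1) (length xs) + 10"
proof -
  obtain Ss where Ss: "calls 11 [input, set_tree xs, Leaf] (family_tree Ss)
      (time_unit z n * call_bound n (d + 1) (length xs))"
    "lists_family Ss (facets (set xs) {})"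
    using computes_facets[of xs "[]"] distinct by auto
  have "calls 0 [input] (family_tree Ss) (time_unit z n * call_bound n (d + 1) (length xs) + 10)"
    unfolding mcc_program_nth
    by (rule computes_weaken, (rule Ss(1)[unfolded input_def] computes_rules computes_Nil | unfold input_def)+)
      simp_all
  moreover have "mcc_program \<noteq> []" unfolding mcc_program_def by simp
  ultimately show ?thesis using Ss(2) unfolding run_def computes_def by blast
qed

end

section \<open>The quasipolynomial bound\<close>

lemma time_unit_le:
  assumes "1 \<le> z"
  shows "time_unit z n + 10 \<le> 2 ^ 14 * (z + n) ^ 9"
proof -
  define Z where "Z = z + n"
  have Z: "1 \<le> Z" "z \<le> Z" "n \<le> Z" "n + 1 \<le> Z" "1 + z \<le> 2 * Z"
    using assms unfolding Z_def by auto
  have pow: "Z ^ i \<le> Z ^ 9" if "i \<le> 9" for i using Z(1) that by (rule power_increasing[rotated])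
  have "z ^ 4 \<le> Z ^ 9" using power_mono[OF Z(2), of 4] pow[of 4] by linarith
  moreover have "n * (15 * n + 45) \<le> Z * (60 * Z)" using Z(1,3) by (intro mult_mono) auto
  then have "n * (15 * n + 45) \<le> 60 * Z ^ 9" using pow[of 2] by (simp add: power2_eq_square)
  moreover have "(2 + n * (n + 1) * (1 + z)) ^ 3 \<le> 64 * Z ^ 9"
  proof -
    have "n * (n + 1) * (1 + z) \<le> Z * Z * (2 * Z)" using Z by (intro mult_mono) auto
    moreover have "1 \<le> Z ^ 3" using Z(1) by simp
    moreover have "Z * Z * (2 * Z) = 2 * Z ^ 3" by (simp add: power3_eq_cube)
    ultimately have "2 + n * (n + 1) * (1 + z) \<le> 4 * Z ^ 3" by linarith
    then have "(2 + n * (n + 1) * (1 + z)) ^ 3 \<le> (4 * Z ^ 3) ^ 3" by (rule power_mono) simp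
    then show ?thesis by (simp add: power_mult_distrib flip: power_mult)
  qed
  moreover have "1 \<le> Z ^ 9" using Z(1) by simp
  \<comment> \<open>The coefficients add up to 300 + 60 + 150 * 64 + 25 + 10 = 9995;
    \<open>2 ^ 14\<close> is the next power of two.\<close>
  ultimately have "time_unit z n + 10 \<le> 10000 * Z ^ 9" unfolding time_unit_def by linarith
  then show ?thesis unfolding Z_def by simp
qed

text \<open>As \<open>N \<ge> 2\<close>, the factor \<open>2 ^ 14\<close> is at most
  \<open>N ^ 14\<close>, so the total exponent is \<open>14 + 9 + 2 * (d + 1) = 25 + 2 * d\<close>.
  With \<open>d \<le> 2 * log 2 N\<close> and \<open>log 2 N \<ge> 1\<close> it is at most
  \<open>29 * log 2 N\<close>.\<close>

lemma quasipolynomial_bound: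
  fixes z n m d :: nat
  assumes "2 \<le> z" "m + 1 \<le> z" "2 ^ d \<le> (m + 1)\<^sup>2"
  defines "N \<equiv> real (z + n)"
  shows "real (time_unit z n * call_bound n (d + 1) m + 10) \<le> N powr (29 * log 2 N ^ 1)"
proof -
  have N: "2 \<le> N" "real (m + 1) \<le> N" using assms(1,2) unfolding N_def by auto
  have log: "1 \<le> log 2 N" using N(1) by (simp add: le_log_iff)
  have "real d = log 2 (2 ^ d)" by simp
  also have "\<dots> \<le> log 2 (N\<^sup>2)"
  proof (subst log_le_cancel_iff)
    have "(2::real) ^ d \<le> (real (m + 1))\<^sup>2" using assms(3) by (metis of_nat_le_iff of_nat_power of_nat_numeral)
    also have "\<dots> \<le> N\<^sup>2" using N(2) by (intro power_mono) auto
    finally show "(2::real) ^ d \<le> N\<^sup>2" .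
  qed (use N(1) in auto)
  also have "\<dots> = 2 * log 2 N" using N(1) by (simp add: log_nat_power)
  finally have "real d \<le> 2 * log 2 N" .
  then have exponent: "25 + 2 * real d \<le> 29 * log 2 N ^ 1"
    using log unfolding power_one_right by linarith
  have "time_unit z n * call_bound n (d + 1) m + 10 \<le> (time_unit z n + 10) * call_bound n (d + 1) m"
    using call_bound_ge_1[of n "d + 1" m] by (simp add: algebra_simps)
  \<comment> \<open>Both \<open>n + 1\<close> and \<open>m + 1\<close> are at most
    \<open>z + n\<close>.\<close>
  also have "\<dots> \<le> 2 ^ 14 * (z + n) ^ 9 * ((z + n) * (z + n)) ^ (d + 1)"
    unfolding call_bound_def using assms(1,2) by (intro mult_mono power_mono time_unit_le) auto
  finally have "time_unit z n * call_bound n (d + 1) m + 10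
      \<le> 2 ^ 14 * (z + n) ^ 9 * ((z + n) * (z + n)) ^ (d + 1)" .
  then have "real (time_unit z n * call_bound n (d + 1) m + 10)
      \<le> real (2 ^ 14 * (z + n) ^ 9 * ((z + n) * (z + n)) ^ (d + 1))"
    by (rule of_nat_mono)
  also have "\<dots> = 2 ^ 14 * N ^ 9 * (N * N) ^ (d + 1)" unfolding N_def by simp
  also have "\<dots> \<le> N ^ 14 * N ^ 9 * (N * N) ^ (d + 1)"
    using N(1) by (intro mult_right_mono power_mono) auto
  also have "\<dots> = N ^ 14 * N ^ 9 * N ^ (2 * (d + 1))" by (simp only: power_mult power2_eq_square)
  also have "\<dots> = N ^ (14 + 9 + 2 * (d + 1))" by (simp only: power_add)
  also have "14 + 9 + 2 * (d + 1) = 25 + 2 * d" by simp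
  also have "N ^ (25 + 2 * d) = N powr (25 + 2 * real d)" using N(1) by (simp flip: powr_realpow)
  also have "\<dots> \<le> N powr (29 * log 2 N ^ 1)" using N(1) exponent by (intro powr_mono) auto
  finally show ?thesis .
qed

section \<open>Encodings\<close>

lemma list_all2_enc_nat: "list_all2 enc_nat xs vs \<longleftrightarrow> vs = map tree_of_nat xs"
  unfolding enc_nat_def list_all2_conv_all_nth by (auto intro: nth_equalityI)

lemma enc_set_nat_iff:
  "enc_set enc_nat A v \<longleftrightarrow> (\<exists>xs. distinct xs \<and> A = set xs \<and> v = set_tree xs)"
  unfolding enc_set_def list_all2_enc_nat by blast

text \<open>Serves to replace an encoded list of sets by a list of lists that represent
  them.\<close>

lemma list_all2_relator:
  assumes "\<And>x v. R x v \<longleftrightarrow> (\<exists>y. P y \<and> x = f y \<and> v = g y)"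
  shows "list_all2 R xs vs \<longleftrightarrow> (\<exists>ys. (\<forall>y\<in>set ys. P y) \<and> xs = map f ys \<and> vs = map g ys)"
proof
  show "list_all2 R xs vs \<Longrightarrow> \<exists>ys. (\<forall>y\<in>set ys. P y) \<and> xs = map f ys \<and> vs = map g ys"
  proof (induction rule: list_all2_induct)
    case (Cons x xs v vs)
    then obtain y ys where "P y" "x = f y" "v = g y" "\<forall>y\<in>set ys. P y" "xs = map f ys" "vs = map g ys"
      using assms by auto
    then show ?case by (intro exI[of _ "y # ys"]) simp
  qed simp
  show "\<exists>ys. (\<forall>y\<in>set ys. P y) \<and> xs = map f ys \<and> vs = map g ys \<Longrightarrow> list_all2 R xs vs"
  proof (elim exE conjE)
    fix ys assume ys: "\<forall>y\<in>set ys. P y" "xs = map f ys" "vs = map g ys"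
    have "R (f y) (g y)" if "y \<in> set ys" for y using assms ys(1) that by blast
    then show ?thesis unfolding ys(2,3) by (simp add: list_all2_conv_all_nth)
  qed
qed

lemma enc_family:
  assumes "lists_family Ss \<F>"
  shows "enc_set (enc_set enc_nat) \<F> (family_tree Ss)"
proof -
  have "enc_set enc_nat (set S) (set_tree S)" if "S \<in> set Ss" for S
    using assms that unfolding lists_family_def enc_set_nat_iff by blast
  then have "list_all2 (enc_set enc_nat) (map set Ss) (map set_tree Ss)"
    by (simp add: list_all2_conv_all_nth)
  then show ?thesis
    using assms unfolding lists_family_def enc_set_def[of "enc_set enc_nat"]
    by (intro exI[of _ "map set Ss"] exI[of _ "map set_tree Ss"]) simp
qed

lemma enc_familyE:
  assumes "enc_set (enc_set enc_nat) \<F> v"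
  obtains Ss where "set ` set Ss = \<F>" "v = family_tree Ss"
proof -
  obtain As vs where As: "set As = \<F>" "list_all2 (enc_set enc_nat) As vs" "v = tree_of_list vs"
    using assms unfolding enc_set_def[of "enc_set enc_nat"] by blast
  obtain Ss where "As = map set Ss" "vs = map set_tree Ss"
    using As(2) unfolding list_all2_relator[OF enc_set_nat_iff] by blast
  then show thesis using that[of Ss] As(1,3) by simp
qed

lemma enc_implication_iff:
  "enc_pair (enc_set enc_nat) (enc_set enc_nat) p v \<longleftrightarrow>
    (\<exists>q. (distinct (fst q) \<and> distinct (snd q)) \<and> p = (\<lambda>(A, B). (set A, set B)) q \<and>
      v = (\<lambda>(A, B). Node (set_tree A) (set_tree B)) q)"
  unfolding enc_pair_def enc_set_nat_iff by (cases p) auto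

lemma enc_baseE:
  assumes "enc_set (enc_pair (enc_set enc_nat) (enc_set enc_nat)) \<Sigma> v"
  obtains \<Gamma> where "base_of \<Gamma> = \<Sigma>" "v = base_tree \<Gamma>"
proof -
  obtain As vs where As: "set As = \<Sigma>" "v = tree_of_list vs"
    "list_all2 (enc_pair (enc_set enc_nat) (enc_set enc_nat)) As vs"
    using assms unfolding enc_set_def[of "enc_pair _ _"] by blast
  obtain \<Gamma> where "As = map (\<lambda>(A, B). (set A, set B)) \<Gamma>"
      "vs = map (\<lambda>(A, B). Node (set_tree A) (set_tree B)) \<Gamma>"
    using As(3) unfolding list_all2_relator[OF enc_implication_iff] by blast
  then show thesis using that[of \<Gamma>] As(1,2) by simp
qed

theorem theorem5:
  "output_quasipolynomial_time enc_mcc_input (enc_set enc_nat)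
     {(X, \<Sigma>, E). mcc_input (X, \<Sigma>, E) \<and> biatomic X \<Sigma> \<and> atomistic X \<Sigma> \<and>
        (\<forall>x\<in>X. \<forall>A. minimal_generator X \<Sigma> x A \<longrightarrow> independent_set X \<Sigma> A)}
     maxCC"
  unfolding output_quasipolynomial_time_def
proof (rule exI[of _ mcc_program], rule exI[of _ 29], rule exI[of _ 1], intro ballI allI impI)
  fix x v
  assume x: "x \<in> {(X, \<Sigma>, E). mcc_input (X, \<Sigma>, E) \<and> biatomic X \<Sigma> \<and> atomistic X \<Sigma> \<and>
        (\<forall>x\<in>X. \<forall>A. minimal_generator X \<Sigma> x A \<longrightarrow> independent_set X \<Sigma> A)}"
    and enc: "enc_mcc_input x v"
  obtain X \<Sigma> E where x_eq: "x = (X, \<Sigma>, E)" by (cases x) auto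
  have inp: "finite X" "implicational_base X \<Sigma>" "simple_graph X E" "biatomic X \<Sigma>" "atomistic X \<Sigma>"
    "\<And>y A. y \<in> X \<Longrightarrow> minimal_generator X \<Sigma> y A \<Longrightarrow> independent_set X \<Sigma> A"
    using x unfolding x_eq mcc_input_def by auto
  obtain a b c where abc: "v = Node a (Node b c)" "enc_set enc_nat X a"
    "enc_set (enc_pair (enc_set enc_nat) (enc_set enc_nat)) \<Sigma> b" "enc_set (enc_set enc_nat) E c"
    using enc unfolding x_eq enc_mcc_input_def enc_pair_def[of "enc_set enc_nat" "enc_pair _ _"]
      enc_pair_def[of "enc_set (enc_pair _ _)"] by auto
  obtain xs where xs: "distinct xs" "X = set xs" "a = set_tree xs" using abc(2) enc_set_nat_iff by auto
  obtain \<Gamma> where \<Gamma>: "base_of \<Gamma> = \<Sigma>" "b = base_tree \<Gamma>" using abc(3) by (rule enc_baseE)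
  obtain Es where Es: "set ` set Es = E" "c = family_tree Es" using abc(4) by (rule enc_familyE)
  \<comment> \<open>The largest \<open>k\<close> with
    \<open>2 ^ k \<le> (card X + 1)\<^sup>2\<close>. The equivalence \<open>le_d\<close> is used for
    the sizes of minimal inconsistent sets and, with \<open>k = d\<close>, for the running
    time.\<close>
  define d where "d = nat \<lfloor>log 2 ((real (card X) + 1)\<^sup>2)\<rfloor>"
  have le_d: "k \<le> d \<longleftrightarrow> 2 ^ k \<le> (card X + 1)\<^sup>2" for k
  proof -
    have "k \<le> d \<longleftrightarrow> real k \<le> log 2 ((real (card X) + 1)\<^sup>2)"
      unfolding d_def using one_le_power[of "real (card X) + 1" 2]
      by (subst le_nat_iff) (simp_all add: le_floor_iff)
    also have "\<dots> \<longleftrightarrow> (2::real) ^ k \<le> (real (card X) + 1)\<^sup>2"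
      by (subst le_log_iff) (simp_all add: powr_realpow)
    also have "\<dots> \<longleftrightarrow> real (2 ^ k) \<le> real ((card X + 1)\<^sup>2)" by (simp add: add.commute)
    finally show ?thesis by (simp only: of_nat_le_iff)
  qed
  interpret mcc_instance xs \<Gamma> Es d
  proof
    fix F assume "F \<subseteq> set xs" "consistent.minimal_nonmember (set xs) (base_of \<Gamma>) (set ` set Es) F"
    \<comment> \<open>Biatomicity, atomisticity and independent minimal generators enter the running
      time here, through the dimension.\<close>
    then show "card F \<le> d"
      unfolding le_d using minimal_inconsistent_card[OF inp] xs(2) \<Gamma>(1) Es(1) by auto
  qed (use xs inp(2) \<Gamma>(1) in auto)
  have v: "v = input" unfolding input_def abc(1) xs(3) \<Gamma>(2) Es(2) ..
  have R: "maxCC x = facets (set xs) {}"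
    unfolding x_eq maxCC_eq_facets[OF inp(2)] using xs(2) \<Gamma>(1) Es(1) by simp
  obtain Ss t where Ss: "run mcc_program input (family_tree Ss) t" "lists_family Ss (facets (set xs) {})"
    "t \<le> time_unit z n * call_bound n (d + 1) (length xs) + 10"
    using run_mcc_program by blast
  have "real t \<le> real (time_unit z n * call_bound n (d + 1) (length xs) + 10)"
    using Ss(3) by (rule of_nat_mono)
  also have "\<dots> \<le> real (z + n) powr (29 * log 2 (real (z + n)) ^ 1)"
  proof (rule quasipolynomial_bound)
    show "2 \<le> z" unfolding z_def input_def using tree_size_ge_1[of "set_tree xs"] by simp
    show "length xs + 1 \<le> z" by (rule size_bounds)
    show "2 ^ d \<le> (length xs + 1)\<^sup>2"
      using le_d[of d] distinct_card[OF xs(1)] xs(2) by simp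
  qed
  finally show "\<exists>w t. run mcc_program v w t \<and> enc_set (enc_set enc_nat) (maxCC x) w \<and>
      (let N = real (tree_size v + card (maxCC x)) in real t \<le> N powr (29 * log 2 N ^ 1))"
    using Ss(1) enc_family[OF Ss(2)] unfolding v R z_def n_def Let_def by blast
qed

end
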